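(* Let $r,s,n$ be positive integers, and set \[ q=\binom{rsn+4^{2^{n-1}+1}}{4^{2^{n-1}+1}},\qquad m=\binom{rsn+2\cdot 4^{2^{n-1}}}{2\cdot 4^{2^{n-1}}}. \] Let $p$ be a prime with \[ p>\left(2^{3\cdot 2^q-2}\right)^{\left(\left(5\cdot 2^q-3\right)^{m+1}-1\right)/\left(5\cdot 2^q-4\right)}. \] Then a sums-of-squares formula of type $[r,s,n]$ exists over an algebraically closed field of characteristic $0$ if and only if a sums-of-squares formula of type $[r,s,n]$ exists over an algebraically closed field of characteristic $p$.
   Context: Let $F$ be a field of characteristic not $2$. A sums-of-squares formula of type $[r,s,n]$ over $F$ is a polynomial identity $(x_1^2+\cdots+x_r^2)(y_1^2+\cdots+y_s^2)=z_1^2+\cdots+z_n^2$ in the polynomial ring $F[x_1,\dots,x_r,y_1,\dots,y_s]$, where each $z_i$ is a bilinear expression in the $x$'s and $y$'s over $F$, i.e. $z_i=\sum_{j,k}\alpha_{ijk}x_jy_k$ with $\alpha_{ijk}\in F$. Here $\binom{a}{b}$ is the binomial coefficient. *)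

theory Defs
  imports
    "HOL-Computational_Algebra.Computational_Algebra"
    "HOL-Library.Poly_Mapping"
begin

datatype var = X nat | Y nat

text \<open>
  Polynomials in the commuting indeterminates \<open>X 1, X 2, \<dots>, Y 1, Y 2, \<dots>\<close>: a finitely supported
  map from exponent vectors (monomials) to coefficients, with the convolution product of
  \<open>Poly_Mapping\<close>. The ring \<open>F[x\<^sub>1,\<dots>,x\<^sub>r,y\<^sub>1,\<dots>,y\<^sub>s]\<close> is the subring
  generated by the constants and the first \<open>r\<close> and \<open>s\<close> indeterminates; every polynomial below
  lies in it.
\<close>

type_synonym 'a xy_poly = "(var \<Rightarrow>\<^sub>0 nat) \<Rightarrow>\<^sub>0 'a"

definition Const :: "'a::comm_ring_1 \<Rightarrow> 'a xy_poly" where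
  "Const c = Poly_Mapping.single 0 c"

definition Var :: "var \<Rightarrow> 'a::comm_ring_1 xy_poly" where
  "Var v = Poly_Mapping.single (Poly_Mapping.single v 1) 1"

definition bilinear_expr :: "nat \<Rightarrow> nat \<Rightarrow> 'a::comm_ring_1 xy_poly \<Rightarrow> bool" where
  "bilinear_expr r s z \<longleftrightarrow>
     (\<exists>\<alpha> :: nat \<Rightarrow> nat \<Rightarrow> 'a. z = (\<Sum>j=1..r. \<Sum>k=1..s. Const (\<alpha> j k) * Var (X j) * Var (Y k)))"

text \<open>
  The field is the type \<open>'a\<close>, passed as \<open>TYPE('a)\<close>. The notion is meant for characteristic
  other than 2; that restriction is left to the places where it is used.
\<close>

definition sos_formula_exists :: "'a::field itself \<Rightarrow> nat \<Rightarrow> nat \<Rightarrow> nat \<Rightarrow> bool" where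
  "sos_formula_exists _ r s n \<longleftrightarrow>
     (\<exists>z :: nat \<Rightarrow> 'a xy_poly.
        (\<forall>i\<in>{1..n}. bilinear_expr r s (z i)) \<and>
        (\<Sum>j=1..r. Var (X j) ^ 2) * (\<Sum>k=1..s. Var (Y k) ^ 2) = (\<Sum>i=1..n. z i ^ 2))"

text \<open>
  The quotient \<open>(a ^ (m + 1) - 1) / (a - 1)\<close> with \<open>a = 5 * 2 ^ q - 3\<close> is an integer, so \<open>div\<close> on
  natural numbers loses nothing; no subtraction in it truncates.
\<close>

lemma exponent_div_exact:
  fixes q m :: nat
  shows "(5 * 2 ^ q - 4) dvd ((5 * 2 ^ q - 3) ^ (m + 1) - 1 :: nat)"
proof -
  define b :: nat where "b = 5 * 2 ^ q - 4"
  have "(1::nat) \<le> 2 ^ q"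
    by (rule one_le_power) simp
  then have b: "5 * 2 ^ q - 3 = b + 1"
    unfolding b_def by linarith
  have "\<exists>c. (b + 1) ^ k = b * c + 1" for k
  proof (induction k)
    case 0
    have "(b + 1) ^ 0 = b * 0 + 1" by simp
    then show ?case by blast
  next
    case (Suc k)
    then obtain c where c: "(b + 1) ^ k = b * c + 1" by blast
    have "(b + 1) ^ Suc k = b * (b * c + c + 1) + 1"
      unfolding power_Suc c by algebra
    then show ?case by blast
  qed
  then obtain c where c: "(b + 1) ^ (m + 1) = b * c + 1" by blast
  show ?thesis
    unfolding b c b_def[symmetric] add_diff_cancel_right' by (rule dvd_triv_left)
qed

end

theory Submission
  imports Defs "Jordan_Normal_Form.Determinant"
begin

text \<open>
  Comparing coefficients at the monomials \<open>x\<^sub>j x\<^sub>j' y\<^sub>k y\<^sub>k'\<close> turns a sums-of-squares formula of type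
  \<open>[r, s, n]\<close> into a common zero of a finite family of quadratic polynomials in the \<open>N = r s n\<close>
  unknown coefficients of the forms \<open>z\<^sub>i\<close>, with integer coefficients that do not depend on the field.
  The theorem therefore says that a particular system over the integers is solvable in characteristic
  \<open>0\<close> exactly when it is solvable in characteristic \<open>p\<close>.

  Over an algebraically closed field the system has no solution precisely when there is a certificate
  \<open>1 = \<Sum>\<tau>. g\<^sub>\<tau> f\<^sub>\<tau>\<close>. The effective Nullstellensatz (lemma \<open>effective_nullstellensatz\<close>) bounds the
  degrees of the \<open>g\<^sub>\<tau>\<close> by a number \<open>D\<close> that depends on \<open>N\<close> only. Finding a certificate of bounded degree
  is a finite system of linear equations with integer entries. By Cramer's rule, its solvability is
  governed by integers below an explicit bound \<open>B\<close>: minors, and the defects of candidate solutions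
  built from minors. If the characteristic of a field is \<open>0\<close> or larger than \<open>B\<close>, such an integer
  vanishes in the field only if it is \<open>0\<close>, so a solution in one such field gives a solution in any
  other (lemma \<open>linear_system_transfer\<close>). Hence certificates, and with them common zeros, exist in
  characteristic \<open>0\<close> if and only if they exist in characteristic \<open>p\<close>, as soon as \<open>p > B\<close>.

  The Nullstellensatz is proved by eliminating one variable at a time. After a linear change of
  coordinates one member \<open>g\<close> of the system is monic in the last variable, so that the polynomials
  modulo \<open>g\<close> form a free module over the polynomials in the other variables; the norm of a suitable
  combination \<open>F\<close> of the system, which is the determinant of multiplication by \<open>F\<close> on this module, is a
  member of the ideal in which the last variable no longer occurs. Each step raises the degree \<open>d\<close> to at
  most \<open>d\<^sup>5\<close>, which gives \<open>D \<le> 2 ^ 6 ^ N\<close> for quadrics and \<open>B \<le> 2 ^ 2 ^ 45 ^ N\<close>.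

  It remains to compare \<open>B\<close> with the bound on \<open>p\<close>, whose size is governed by \<open>n\<close> rather than by \<open>N\<close>.
  Outside characteristic \<open>2\<close> a formula makes certain vectors in \<open>n\<close>-space orthonormal, which is
  impossible unless \<open>r \<le> n\<close> and \<open>s \<le> n\<close>. So either there is no formula over either of the two fields, or
  \<open>N \<le> n\<^sup>3\<close>; in the second case \<open>q \<ge> 9 ^ N\<close> and \<open>m \<ge> 5 ^ N\<close>, and the bound on \<open>p\<close> is at least \<open>2 ^ 2 ^ (q m)\<close>.
\<close>

section \<open>Polynomial functions of bounded degree\<close>

text \<open>
  Polynomial functions in the coordinates below \<open>N\<close>, of total degree at most \<open>d\<close>. Functions are as good
  as polynomials over an infinite field. A point assigns a value to every natural number, so that the
  number of variables can change in an induction while the type of points stays the same.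
\<close>

inductive polyfun :: "nat \<Rightarrow> nat \<Rightarrow> ((nat \<Rightarrow> 'k::comm_ring_1) \<Rightarrow> 'k) \<Rightarrow> bool" for N where
  const: "polyfun N d (\<lambda>_. c)"
| var: "i < N \<Longrightarrow> polyfun N d f \<Longrightarrow> polyfun N (Suc d) (\<lambda>a. a i * f a)"
| add: "polyfun N d f \<Longrightarrow> polyfun N d g \<Longrightarrow> polyfun N d (\<lambda>a. f a + g a)"

lemma polyfun_mono: "polyfun N d f \<Longrightarrow> d \<le> d' \<Longrightarrow> polyfun N d' f"
proof (induction arbitrary: d' rule: polyfun.induct)
  case (var i d f)
  then obtain d'' where "d' = Suc d''" "d \<le> d''" by (cases d') auto
  then show ?case using var polyfun.var by blast
qed (auto intro: polyfun.intros)

lemma polyfun_mono_vars: "polyfun N d f \<Longrightarrow> N \<le> N' \<Longrightarrow> polyfun N' d f"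
proof (induction rule: polyfun.induct)
  case (var i d f)
  then show ?case by (intro polyfun.var) auto
qed (auto intro: polyfun.intros)

lemma polyfun_cong_point: "polyfun N d f \<Longrightarrow> (\<And>i. i < N \<Longrightarrow> a i = b i) \<Longrightarrow> f a = f b"
  by (induction rule: polyfun.induct) auto

lemma polyfun_scale: "polyfun N d f \<Longrightarrow> polyfun N d (\<lambda>a. c * f a)"
proof (induction rule: polyfun.induct)
  case (var i d f)
  then have "polyfun N (Suc d) (\<lambda>a. a i * (c * f a))" by (intro polyfun.var)
  then show ?case by (simp add: ac_simps)
qed (auto simp: distrib_left intro: polyfun.intros)

lemma polyfun_mult:
  "polyfun N d f \<Longrightarrow> polyfun N d' g \<Longrightarrow> polyfun N (d + d') (\<lambda>a. f a * g a)"
proof (induction rule: polyfun.induct)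
  case (const d c)
  then show ?case by (rule polyfun_mono[OF polyfun_scale]) simp
next
  case (var i d f)
  then have "polyfun N (Suc (d + d')) (\<lambda>a. a i * (f a * g a))" by (intro polyfun.var)
  then show ?case by (simp add: ac_simps)
qed (auto simp: distrib_right intro: polyfun.intros)

lemma polyfun_coord: "i < N \<Longrightarrow> 0 < d \<Longrightarrow> polyfun N d (\<lambda>a. a i)"
  using polyfun.var[OF _ polyfun.const[of N "d - 1" 1]] by simp

lemma polyfun_minus: "polyfun N d f \<Longrightarrow> polyfun N d (\<lambda>a. - f a)"
  using polyfun_scale[of N d f "-1"] by simp

lemma polyfun_diff: "polyfun N d f \<Longrightarrow> polyfun N d g \<Longrightarrow> polyfun N d (\<lambda>a. f a - g a)"
  using polyfun.add[OF _ polyfun_minus, of N d f g] by simp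

lemma polyfun_sum: "(\<And>x. x \<in> I \<Longrightarrow> polyfun N d (f x)) \<Longrightarrow> polyfun N d (\<lambda>a. \<Sum>x\<in>I. f x a)"
  by (induction I rule: infinite_finite_induct) (auto intro: polyfun.intros)

lemma polyfun_prod:
  "finite I \<Longrightarrow> (\<And>x. x \<in> I \<Longrightarrow> polyfun N (d x) (f x)) \<Longrightarrow> polyfun N (\<Sum>x\<in>I. d x) (\<lambda>a. \<Prod>x\<in>I. f x a)"
  by (induction I rule: finite_induct) (auto intro: polyfun.intros polyfun_mult)

lemma polyfun_power: "polyfun N d f \<Longrightarrow> polyfun N (k * d) (\<lambda>a. f a ^ k)"
  by (induction k) (auto intro: polyfun.const polyfun_mult)

text \<open>
  Expansion in powers of the last coordinate;
  the degree \<open>d - k\<close> of the \<open>k\<close>-th coefficient records that the total degree is at most \<open>d\<close>.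
\<close>

lemma polyfun_last:
  assumes "polyfun (Suc N) d f"
  obtains h where "\<And>k. polyfun N (d - k) (h k)" "\<And>a. f a = (\<Sum>k\<le>d. h k a * a N ^ k)"
proof -
  have "\<exists>h. (\<forall>k. polyfun N (d - k) (h k)) \<and> (\<forall>k>d. h k = (\<lambda>_. 0)) \<and>
            (\<forall>a. f a = (\<Sum>k\<le>d. h k a * a N ^ k))"
    using assms
  proof (induction rule: polyfun.induct)
    case (const d c)
    have "(\<Sum>k\<le>d. (if k = 0 then c else 0) * x ^ k) = c" for x
      by (subst sum.remove[of _ 0]) (auto intro!: sum.neutral)
    then show ?case
      by (intro exI[of _ "\<lambda>k _. if k = 0 then c else 0"]) (auto intro: polyfun.const)
  next
    case (var i d f)
    then obtain h where h: "\<And>k. polyfun N (d - k) (h k)" "\<And>k. k > d \<Longrightarrow> h k = (\<lambda>_. 0)"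
      "\<And>a. f a = (\<Sum>k\<le>d. h k a * a N ^ k)" by blast
    show ?case
    proof (cases "i = N")
      case True
      let ?h = "\<lambda>k. case k of 0 \<Rightarrow> (\<lambda>_. 0) | Suc l \<Rightarrow> h l"
      have "polyfun N (Suc d - k) (?h k)" for k
        by (cases k) (auto intro: polyfun.const h)
      moreover have "a i * f a = (\<Sum>k\<le>Suc d. ?h k a * a N ^ k)" for a
        unfolding h(3) True by (subst sum.atMost_Suc_shift) (simp add: sum_distrib_left ac_simps)
      ultimately show ?thesis
        using h(2) by (intro exI[of _ ?h]) (auto split: nat.split)
    next
      case False
      with var have i: "i < N" by simp
      let ?h = "\<lambda>k a. a i * h k a"
      have "polyfun N (Suc d - k) (?h k)" for k
      proof (cases "k \<le> d")
        case True
        then show ?thesis using polyfun.var[OF i h(1)[of k]] by (simp add: Suc_diff_le)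
      qed (auto simp: h(2) intro: polyfun.const)
      moreover have "a i * f a = (\<Sum>k\<le>Suc d. ?h k a * a N ^ k)" for a
        unfolding h(3) by (simp add: sum_distrib_left h(2) ac_simps)
      ultimately show ?thesis
        using h(2) by (intro exI[of _ ?h]) auto
    qed
  next
    case (add d f g)
    obtain h where h: "\<And>k. polyfun N (d - k) (h k)" "\<And>k. k > d \<Longrightarrow> h k = (\<lambda>_. 0)"
      "\<And>a. f a = (\<Sum>k\<le>d. h k a * a N ^ k)" using add.IH(1) by blast
    obtain h' where h': "\<And>k. polyfun N (d - k) (h' k)" "\<And>k. k > d \<Longrightarrow> h' k = (\<lambda>_. 0)"
      "\<And>a. g a = (\<Sum>k\<le>d. h' k a * a N ^ k)" using add.IH(2) by blast
    show ?case
    proof (intro exI[of _ "\<lambda>k a. h k a + h' k a"] conjI allI impI)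
      show "polyfun N (d - k) (\<lambda>a. h k a + h' k a)" for k by (intro polyfun.add h h')
    qed (simp_all add: h h' distrib_right sum.distrib)
  qed
  then show ?thesis using that by blast
qed

lemma polyfun_univariate:
  assumes "polyfun (Suc N) d f"
  obtains p where "degree p \<le> d" "\<And>t. f (a(N := t)) = poly p t"
proof -
  obtain h where h: "\<And>k. polyfun N (d - k) (h k)" "\<And>a. f a = (\<Sum>k\<le>d. h k a * a N ^ k)"
    using polyfun_last[OF assms] by blast
  have "h k (a(N := t)) = h k a" for k t
    by (rule polyfun_cong_point[OF h(1)]) auto
  then have "f (a(N := t)) = poly (\<Sum>k\<le>d. monom (h k a) k) t" for t
    by (simp add: h(2) poly_sum poly_monom)
  moreover have "degree (\<Sum>k\<le>d. monom (h k a) k) \<le> d"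
    by (intro degree_sum_le) (auto intro: order.trans[OF degree_monom_le])
  ultimately show ?thesis using that by blast
qed

lemma poly_zero_if_many_roots:
  fixes h :: "nat \<Rightarrow> 'k::idom"
  assumes "inj_on (of_nat :: nat \<Rightarrow> 'k) {..d}"
    and "\<And>t. t \<le> d \<Longrightarrow> (\<Sum>k\<le>d. h k * of_nat t ^ k) = 0" and "k \<le> d"
  shows "h k = 0"
proof -
  let ?p = "\<Sum>k\<le>d. monom (h k) k"
  have "?p = 0"
  proof (rule ccontr)
    assume p: "?p \<noteq> 0"
    have "of_nat ` {..d} \<subseteq> {t. poly ?p t = 0}"
      using assms(2) by (auto simp: poly_sum poly_monom)
    then have "card (of_nat ` {..d} :: 'k set) \<le> card {t. poly ?p t = 0}"
      by (intro card_mono poly_roots_finite p)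
    also have "\<dots> \<le> degree ?p" by (rule card_poly_roots_bound[OF p])
    also have "\<dots> \<le> d" by (intro degree_sum_le) (auto intro: order.trans[OF degree_monom_le])
    finally show False using card_image[OF assms(1)] by simp
  qed
  then have "coeff ?p k = 0" by simp
  then show ?thesis using assms(3) by (simp add: coeff_sum)
qed

text \<open>
  On a line parallel to the last axis the function is a univariate polynomial of degree at most \<open>d\<close> with
  \<open>d + 1\<close> roots, so every coefficient of the expansion in the last coordinate vanishes on a smaller grid.
  Thus an identity of polynomial functions amounts to finitely many equations at points with integer
  coordinates, the same points for every field in which \<open>0, \<dots>, d\<close> are distinct.
\<close>

lemma polyfun_zero_if_zero_on_grid:
  fixes f :: "(nat \<Rightarrow> 'k::idom) \<Rightarrow> 'k"
  assumes "polyfun N d f" and "inj_on (of_nat :: nat \<Rightarrow> 'k) {..d}"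
    and "\<And>u. u \<in> {..<N} \<rightarrow>\<^sub>E {..d} \<Longrightarrow> f (\<lambda>i. of_nat (u i)) = 0"
  shows "f a = 0"
proof -
  have "f a = 0" if "polyfun N d' f" "d' \<le> d"
    "\<And>u. (\<forall>i<N. u i \<le> d) \<Longrightarrow> f (\<lambda>i. of_nat (u i)) = 0"
    for f :: "(nat \<Rightarrow> 'k) \<Rightarrow> 'k" and d' a
    using that
  proof (induction N arbitrary: f d' a)
    case 0
    have "f a = f (\<lambda>i. of_nat 0)" by (rule polyfun_cong_point[OF 0(1)]) auto
    then show ?case using 0(3)[of "\<lambda>_. 0"] by simp
  next
    case (Suc N)
    obtain h where h: "\<And>k. polyfun N (d' - k) (h k)" "\<And>a. f a = (\<Sum>k\<le>d'. h k a * a N ^ k)"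
      using polyfun_last[OF Suc.prems(1)] by blast
    have inj: "inj_on (of_nat :: nat \<Rightarrow> 'k) {..d'}"
      using inj_on_subset[OF assms(2)] Suc.prems(2) by simp
    have "h k a = 0" if k: "k \<le> d'" for k a
    proof (rule Suc.IH[OF h(1)])
      fix u :: "nat \<Rightarrow> nat" assume u: "\<forall>i<N. u i \<le> d"
      show "h k (\<lambda>i. of_nat (u i)) = 0"
      proof (rule poly_zero_if_many_roots[OF inj _ k, of "\<lambda>k. h k (\<lambda>i. of_nat (u i))"])
        fix t assume "t \<le> d'"
        then have "f (\<lambda>i. of_nat ((u(N := t)) i)) = 0"
          using u Suc.prems(2) by (intro Suc.prems(3)) (auto simp: less_Suc_eq)
        moreover have "h k (\<lambda>i. of_nat ((u(N := t)) i)) = h k (\<lambda>i. of_nat (u i))" for k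
          by (rule polyfun_cong_point[OF h(1)]) auto
        ultimately show "(\<Sum>k\<le>d'. h k (\<lambda>i. of_nat (u i)) * of_nat t ^ k) = 0"
          by (simp add: h(2))
      qed
    qed (use Suc.prems in auto)
    then show ?case by (simp add: h(2))
  qed
  note * = this
  show ?thesis
  proof (rule *[OF assms(1) order.refl])
    fix u :: "nat \<Rightarrow> nat" assume u: "\<forall>i<N. u i \<le> d"
    have "f (\<lambda>i. of_nat (u i)) = f (\<lambda>i. of_nat (restrict u {..<N} i))"
      by (rule polyfun_cong_point[OF assms(1)]) auto
    also have "\<dots> = 0" using u by (intro assms(3)) (auto simp: PiE_def extensional_def)
    finally show "f (\<lambda>i. of_nat (u i)) = 0" .
  qed
qed

definition monomial_at :: "nat \<Rightarrow> (nat \<Rightarrow> nat) \<Rightarrow> (nat \<Rightarrow> 'k::comm_ring_1) \<Rightarrow> 'k" where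
  "monomial_at N e a = (\<Prod>i<N. a i ^ e i)"

text \<open>
  The exponents range over the box \<open>{..d} ^ N\<close> rather than over those of total degree at most \<open>d\<close>: the
  cardinality of the box is immediate, and the loss is immaterial for the bounds.
\<close>

lemma polyfun_monomial_expansion:
  fixes f :: "(nat \<Rightarrow> 'k::comm_ring_1) \<Rightarrow> 'k"
  assumes "polyfun N d f"
  shows "\<exists>c. \<forall>a. f a = (\<Sum>e\<in>{..<N} \<rightarrow>\<^sub>E {..d}. c e * monomial_at N e a)"
proof -
  have "\<exists>c. \<forall>a. f a = (\<Sum>e\<in>{..<N} \<rightarrow>\<^sub>E {..d}. c e * monomial_at N e a)"
    if "polyfun N d' f" "d' \<le> d" for f :: "(nat \<Rightarrow> 'k) \<Rightarrow> 'k" and d'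
    using that
  proof (induction N arbitrary: f d')
    case 0
    have "f a = f (\<lambda>_. 0)" for a by (rule polyfun_cong_point[OF 0(1)]) auto
    then show ?case by (intro exI[of _ "\<lambda>_. f (\<lambda>_. 0)"]) (simp add: monomial_at_def)
  next
    case (Suc N)
    obtain h where h: "\<And>k. polyfun N d (h k)" "\<And>a. f a = (\<Sum>k\<le>d. h k a * a N ^ k)"
      using polyfun_last[OF polyfun_mono[OF Suc.prems]] polyfun_mono by (metis diff_le_self)
    from Suc.IH[OF h(1) order.refl] obtain c where
      c: "\<And>k a. h k a = (\<Sum>e\<in>{..<N} \<rightarrow>\<^sub>E {..d}. c k e * monomial_at N e a)" by metis
    let ?B = "{..<N} \<rightarrow>\<^sub>E {..d}"
    let ?upd = "\<lambda>(y, g). g(N := y)"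
    have set_eq: "{..<Suc N} \<rightarrow>\<^sub>E {..d} = ?upd ` ({..d} \<times> ?B)"
      by (simp add: lessThan_Suc PiE_insert_eq)
    have inj: "inj_on ?upd ({..d} \<times> ?B)"
      using inj_combinator[of N "{..<N}" "\<lambda>_. {..d}"] by simp
    let ?c = "\<lambda>e. c (e N) (e(N := undefined))"
    have "f a = (\<Sum>e\<in>{..<Suc N} \<rightarrow>\<^sub>E {..d}. ?c e * monomial_at (Suc N) e a)" for a
    proof -
      have summand: "?c (?upd x) * monomial_at (Suc N) (?upd x) a
          = (case x of (y, g) \<Rightarrow> c y g * (monomial_at N g a * a N ^ y))"
        if "x \<in> {..d} \<times> ?B" for x
      proof (cases x)
        case (Pair y g)
        with that have "g N = undefined" by (auto simp: PiE_def extensional_def)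
        then have "(g(N := y))(N := undefined) = g" by (simp add: fun_upd_idem)
        moreover have "monomial_at (Suc N) (g(N := y)) a = monomial_at N g a * a N ^ y"
          unfolding monomial_at_def by simp
        ultimately show ?thesis by (simp add: Pair)
      qed
      have "(\<Sum>e\<in>{..<Suc N} \<rightarrow>\<^sub>E {..d}. ?c e * monomial_at (Suc N) e a)
        = (\<Sum>(y, g)\<in>{..d} \<times> ?B. c y g * (monomial_at N g a * a N ^ y))"
        unfolding set_eq sum.reindex[OF inj] comp_def by (rule sum.cong[OF refl summand])
      also have "\<dots> = (\<Sum>y\<le>d. \<Sum>g\<in>?B. c y g * (monomial_at N g a * a N ^ y))"
        by (rule sum.cartesian_product[symmetric])
      also have "\<dots> = (\<Sum>y\<le>d. h y a * a N ^ y)"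
        unfolding c sum_distrib_right by (simp add: mult.assoc)
      also have "\<dots> = f a" by (rule h(2)[symmetric])
      finally show ?thesis by simp
    qed
    then show ?case by (intro exI[of _ ?c] allI)
  qed
  then show ?thesis using assms by blast
qed

lemma polyfun_monomial_at:
  assumes "e \<in> {..<N} \<rightarrow>\<^sub>E {..d}"
  shows "polyfun N (N * d) (monomial_at N e)"
proof -
  have "polyfun N (\<Sum>i<N. d) (\<lambda>a. \<Prod>i<N. a i ^ e i)"
  proof (rule polyfun_prod)
    fix i assume i: "i \<in> {..<N}"
    then have "polyfun N (e i * 1) (\<lambda>a. a i ^ e i)"
      by (intro polyfun_power polyfun_coord) auto
    then show "polyfun N d (\<lambda>a. a i ^ e i)"
      by (rule polyfun_mono) (use assms i in auto)
  qed simp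
  then show ?thesis by (simp add: monomial_at_def[abs_def])
qed

section \<open>Shearing coordinates\<close>

text \<open>
  The linear change of coordinates that adds \<open>a N\<close> times the direction \<open>v\<close> to the first \<open>N\<close> coordinates
  and keeps the last one. The axis of the last coordinate is moved to the line through \<open>(v, 1)\<close>.
\<close>

definition shear :: "nat \<Rightarrow> (nat \<Rightarrow> 'k) \<Rightarrow> (nat \<Rightarrow> 'k) \<Rightarrow> nat \<Rightarrow> 'k::comm_ring_1" where
  "shear N v a = (\<lambda>i. if i < N then a i + a N * v i else a i)"

lemma polyfun_shear:
  assumes "polyfun (Suc N) d f"
  shows "polyfun (Suc N) d (\<lambda>a. f (shear N v a))"
  using assms
proof (induction rule: polyfun.induct)
  case (var i d f)
  show ?case
  proof (cases "i < N")
    case True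
    have "polyfun (Suc N) (Suc d) (\<lambda>a. a i * f (shear N v a) + v i * (a N * f (shear N v a)))"
      using var by (intro polyfun.add polyfun_scale polyfun.var) auto
    then show ?thesis using True by (simp add: shear_def algebra_simps)
  next
    case False
    then show ?thesis using polyfun.var[OF var(1,3)] by (simp add: shear_def)
  qed
qed (auto intro: polyfun.const polyfun.add)

lemma shear_inverse: "shear N v (shear N (\<lambda>i. - v i) a) = a"
  by (auto simp: shear_def)

inductive homogeneous :: "nat \<Rightarrow> nat \<Rightarrow> ((nat \<Rightarrow> 'k::comm_ring_1) \<Rightarrow> 'k) \<Rightarrow> bool" for N where
  zero: "homogeneous N d (\<lambda>_. 0)"
| const: "homogeneous N 0 (\<lambda>_. c)"
| var: "i < N \<Longrightarrow> homogeneous N d f \<Longrightarrow> homogeneous N (Suc d) (\<lambda>a. a i * f a)"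
| add: "homogeneous N d f \<Longrightarrow> homogeneous N d g \<Longrightarrow> homogeneous N d (\<lambda>a. f a + g a)"

lemma homogeneous_scale: "homogeneous N d f \<Longrightarrow> f (\<lambda>i. s * a i) = s ^ d * f a"
  by (induction rule: homogeneous.induct) (auto simp: algebra_simps)

text \<open>
  The homogeneous part of degree \<open>d\<close>, split off without speaking of coefficients. In degree \<open>0\<close> the
  truncated \<open>d - 1\<close> would allow a constant remainder, hence the separate clause for \<open>L\<close>.
\<close>

lemma polyfun_top_form:
  assumes "polyfun N d f"
  obtains T L where "homogeneous N d T" "polyfun N (d - 1) L" "d = 0 \<Longrightarrow> L = (\<lambda>_. 0)"
    "\<And>a. f a = T a + L a"
proof -
  have "\<exists>T L. homogeneous N d T \<and> polyfun N (d - 1) L \<and> (d = 0 \<longrightarrow> L = (\<lambda>_. 0)) \<and>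
          (\<forall>a. f a = T a + L a)"
    using assms
  proof (induction rule: polyfun.induct)
    case (const d c)
    show ?case
    proof (cases "d = 0")
      case True
      then show ?thesis
        by (intro exI[of _ "\<lambda>_. c"] exI[of _ "\<lambda>_. 0"])
          (auto intro: homogeneous.const polyfun.const)
    next
      case False
      then show ?thesis
        by (intro exI[of _ "\<lambda>_. c"] exI[of _ "\<lambda>_. 0"])
          (auto intro: homogeneous.zero polyfun.const)
    qed
  next
    case (var i d f)
    then obtain T L where IH: "homogeneous N d T" "polyfun N (d - 1) L"
      "d = 0 \<longrightarrow> L = (\<lambda>_. 0)" "\<forall>a. f a = T a + L a" by blast
    have "polyfun N d (\<lambda>a. a i * L a)"
    proof (cases d)
      case 0
      then show ?thesis using IH(3) by (simp add: polyfun.const)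
    next
      case (Suc d')
      then show ?thesis using polyfun.var[OF var(1) IH(2)] by simp
    qed
    then show ?case
      using IH var(1)
      by (intro exI[of _ "\<lambda>a. a i * T a"] exI[of _ "\<lambda>a. a i * L a"])
        (auto simp: distrib_left intro: homogeneous.var)
  next
    case (add d f g)
    obtain T L where 1: "homogeneous N d T" "polyfun N (d - 1) L"
      "d = 0 \<longrightarrow> L = (\<lambda>_. 0)" "\<forall>a. f a = T a + L a" using add.IH(1) by blast
    obtain T' L' where 2: "homogeneous N d T'" "polyfun N (d - 1) L'"
      "d = 0 \<longrightarrow> L' = (\<lambda>_. 0)" "\<forall>a. g a = T' a + L' a" using add.IH(2) by blast
    show ?case
    proof (rule exI[of _ "\<lambda>a. T a + T' a"], rule exI[of _ "\<lambda>a. L a + L' a"], intro conjI)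
      show "homogeneous N d (\<lambda>a. T a + T' a)" by (rule homogeneous.add[OF 1(1) 2(1)])
      show "polyfun N (d - 1) (\<lambda>a. L a + L' a)" by (rule polyfun.add[OF 1(2) 2(2)])
    qed (use 1 2 in auto)
  qed
  then show ?thesis using that by blast
qed

text \<open>
  Restricted to the sheared last axis, a form of degree \<open>d\<close> is its value at \<open>(v, 1)\<close> times the \<open>d\<close>-th power
  of the parameter. Therefore the leading coefficient after the shear is a constant.
\<close>

lemma homogeneous_shear:
  assumes "homogeneous (Suc N) d T"
  obtains h where "\<And>k. k < d \<Longrightarrow> polyfun N d (h k)"
    "\<And>a. T (shear N v a) = T (v(N := 1)) * a N ^ d + (\<Sum>k<d. h k a * a N ^ k)"
proof -
  have "\<exists>h. (\<forall>k<d. polyfun N d (h k)) \<and>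
     (\<forall>a. T (shear N v a) = T (v(N := 1)) * a N ^ d + (\<Sum>k<d. h k a * a N ^ k))"
    using assms
  proof (induction rule: homogeneous.induct)
    case (zero d)
    show ?case by (intro exI[of _ "\<lambda>_ _. 0"]) (simp add: polyfun.const)
  next
    case (const c)
    show ?case by (intro exI[of _ "\<lambda>_ _. 0"]) simp
  next
    case (var i d f)
    then obtain h where h: "\<And>k. k < d \<Longrightarrow> polyfun N d (h k)"
      "\<And>a. f (shear N v a) = f (v(N := 1)) * a N ^ d + (\<Sum>k<d. h k a * a N ^ k)" by blast
    \<comment> \<open>the multiple of \<open>x\<^sub>N\<close> shifts the coefficients up by one place\<close>
    let ?up = "\<lambda>k. case k of 0 \<Rightarrow> (\<lambda>_. 0) | Suc l \<Rightarrow> h l"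
    have up: "(\<Sum>k<Suc d. ?up k a * a N ^ k) = a N * (\<Sum>k<d. h k a * a N ^ k)" for a
      by (subst sum.lessThan_Suc_shift) (simp add: sum_distrib_left ac_simps)
    have up_poly: "polyfun N (Suc d) (?up k)" if "k < Suc d" for k
      using that by (cases k) (auto intro: polyfun.const polyfun_mono[OF h(1)])
    show ?case
    proof (cases "i < N")
      case True
      let ?h = "\<lambda>k a. (if k < d then a i * h k a else a i * f (v(N := 1))) + v i * ?up k a"
      have "polyfun N (Suc d) (?h k)" if "k < Suc d" for k
        using that True
        by (cases "k < d") (auto intro!: polyfun.add polyfun_scale up_poly polyfun.var h(1) polyfun.const)
      moreover have "(shear N v a i) * f (shear N v a)
        = (v i * f (v(N := 1))) * a N ^ Suc d + (\<Sum>k<Suc d. ?h k a * a N ^ k)" for a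
      proof -
        have "(\<Sum>k<Suc d. ?h k a * a N ^ k)
          = (\<Sum>k<Suc d. (if k < d then a i * h k a else a i * f (v(N := 1))) * a N ^ k)
            + v i * (\<Sum>k<Suc d. ?up k a * a N ^ k)"
          by (simp only: distrib_right sum.distrib sum_distrib_left mult.assoc)
        also have "(\<Sum>k<Suc d. (if k < d then a i * h k a else a i * f (v(N := 1))) * a N ^ k)
          = a i * (\<Sum>k<d. h k a * a N ^ k) + a i * f (v(N := 1)) * a N ^ d"
          by (simp add: sum_distrib_left mult.assoc)
        finally show ?thesis
          unfolding up h(2) using True by (simp add: shear_def algebra_simps)
      qed
      moreover have "(v(N := 1)) i = v i" using True by simp
      ultimately show ?thesis by (intro exI[of _ ?h] conjI allI impI) (simp_all only:)
    next
      case False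
      with var have i: "i = N" by simp
      show ?thesis
      proof (intro exI[of _ ?up] conjI allI impI)
        fix a
        have "shear N v a i = a N" by (simp add: shear_def i)
        then show "shear N v a i * f (shear N v a) = (v(N := 1)) i * f (v(N := 1)) * a N ^ Suc d
          + (\<Sum>k<Suc d. ?up k a * a N ^ k)"
          unfolding up h(2) by (simp add: i algebra_simps)
      qed (rule up_poly)
    qed
  next
    case (add d f g)
    obtain h where 1: "\<And>k. k < d \<Longrightarrow> polyfun N d (h k)"
      "\<And>a. f (shear N v a) = f (v(N := 1)) * a N ^ d + (\<Sum>k<d. h k a * a N ^ k)"
      using add.IH(1) by blast
    obtain h' where 2: "\<And>k. k < d \<Longrightarrow> polyfun N d (h' k)"
      "\<And>a. g (shear N v a) = g (v(N := 1)) * a N ^ d + (\<Sum>k<d. h' k a * a N ^ k)"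
      using add.IH(2) by blast
    show ?case
    proof (intro exI[of _ "\<lambda>k a. h k a + h' k a"] conjI allI impI)
      show "polyfun N d (\<lambda>a. h k a + h' k a)" if "k < d" for k
        by (intro polyfun.add 1(1) 2(1) that)
    qed (simp add: 1(2) 2(2) algebra_simps sum.distrib del: fun_upd_apply)
  qed
  then show ?thesis using that by blast
qed

text \<open>
  By homogeneity the form vanishes wherever the last coordinate is nonzero. In the last coordinate it is
  a polynomial with infinitely many roots, so it vanishes on the remaining hyperplane as well.
\<close>

lemma homogeneous_zero_if_zero_on_chart:
  fixes T :: "(nat \<Rightarrow> 'k::field) \<Rightarrow> 'k"
  assumes inf: "infinite (UNIV :: 'k set)"
    and T: "homogeneous (Suc N) d T" "polyfun (Suc N) d T"
    and chart: "\<And>v. T (v(N := 1)) = 0"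
  shows "T a = 0"
proof -
  have nz: "T a = 0" if "a N \<noteq> 0" for a
  proof -
    \<comment> \<open>rescale the point so that its last coordinate becomes \<open>1\<close>\<close>
    let ?v = "\<lambda>i. inverse (a N) * a i"
    have "T (\<lambda>i. a N * (?v(N := 1)) i) = 0"
      unfolding homogeneous_scale[OF T(1)] chart by simp
    moreover have "(\<lambda>i. a N * (?v(N := 1)) i) = a" using that by (auto simp: fun_eq_iff)
    ultimately show ?thesis by simp
  qed
  obtain p where p: "\<And>t. T (a(N := t)) = poly p t" by (rule polyfun_univariate[OF T(2)]) blast
  have "p = 0"
  proof (rule ccontr)
    assume "p \<noteq> 0"
    then have "finite (insert 0 {t. poly p t = 0})" by (simp add: poly_roots_finite)
    then obtain t where "t \<notin> insert 0 {t. poly p t = 0}" using inf ex_new_if_finite by blast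
    then show False using nz[of "a(N := t)"] p by auto
  qed
  then show ?thesis using p[of "a N"] by simp
qed

text \<open>
  Noether's normalisation: choose \<open>e\<close> as the exact degree of \<open>g\<close>. Then the form of degree \<open>e\<close> is not zero,
  hence not zero at some \<open>(v, 1)\<close>, and shearing in the direction \<open>v\<close> makes this value the coefficient of
  the \<open>e\<close>-th power of the last coordinate.
\<close>

lemma polyfun_monic_after_shear:
  fixes g :: "(nat \<Rightarrow> 'k::field) \<Rightarrow> 'k"
  assumes inf: "infinite (UNIV :: 'k set)" and g: "polyfun (Suc N) d g" and nz: "g b \<noteq> 0"
  shows "\<exists>e v c h. e \<le> d \<and> c \<noteq> 0 \<and> (\<forall>k<e. polyfun N e (h k)) \<and>
           (\<forall>a. g (shear N v a) = c * a N ^ e + (\<Sum>k<e. h k a * a N ^ k))"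
proof -
  define e where "e = (LEAST e. polyfun (Suc N) e g)"
  have ge: "polyfun (Suc N) e g" unfolding e_def by (rule LeastI[of _ d]) (rule g)
  have e: "e \<le> d" unfolding e_def by (rule Least_le[of _ d]) (rule g)
  obtain T L where TL: "homogeneous (Suc N) e T" "polyfun (Suc N) (e - 1) L"
    "e = 0 \<Longrightarrow> L = (\<lambda>_. 0)" "\<And>a. g a = T a + L a"
    using polyfun_top_form[OF ge] by blast
  have "polyfun (Suc N) e (\<lambda>a. g a - L a)"
    by (rule polyfun_diff[OF ge polyfun_mono[OF TL(2)]]) simp
  then have Tp: "polyfun (Suc N) e T" using TL(4) by simp
  have "\<exists>v. T (v(N := 1)) \<noteq> 0"
  proof (rule ccontr)
    assume "\<nexists>v. T (v(N := 1)) \<noteq> 0"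
    then have "T a = 0" for a using homogeneous_zero_if_zero_on_chart[OF inf TL(1) Tp] by blast
    then have gL: "g = L" using TL(4) by auto
    \<comment> \<open>then \<open>g\<close> would have degree less than \<open>e\<close>, or be zero if \<open>e = 0\<close>\<close>
    show False
    proof (cases "e = 0")
      case True
      then show False using TL(3) gL nz by simp
    next
      case False
      have "e \<le> e - 1" unfolding e_def
        by (rule Least_le) (use gL TL(2) in \<open>simp add: e_def\<close>)
      with False show False by simp
    qed
  qed
  then obtain v where v: "T (v(N := 1)) \<noteq> 0" by blast
  obtain h where h: "\<And>k. k < e \<Longrightarrow> polyfun N e (h k)"
    "\<And>a. T (shear N v a) = T (v(N := 1)) * a N ^ e + (\<Sum>k<e. h k a * a N ^ k)"
    using homogeneous_shear[OF TL(1)] by blast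
  have "\<exists>l. (\<forall>k. polyfun N e (l k)) \<and> (\<forall>a. L (shear N v a) = (\<Sum>k<e. l k a * a N ^ k))"
  proof (cases e)
    case 0
    then show ?thesis using TL(3) by (auto intro: exI[of _ "\<lambda>_ _. 0"] polyfun.const)
  next
    case (Suc e')
    obtain l where l: "\<And>k. polyfun N (e' - k) (l k)"
      "\<And>a. L (shear N v a) = (\<Sum>k\<le>e'. l k a * a N ^ k)"
      using polyfun_last[OF polyfun_shear[OF TL(2), of v]] Suc by auto
    have "polyfun N e (l k)" for k by (rule polyfun_mono[OF l(1)]) (simp add: Suc)
    then show ?thesis using l(2) Suc by (auto simp: lessThan_Suc_atMost)
  qed
  then obtain l where l: "\<And>k. polyfun N e (l k)"
    "\<And>a. L (shear N v a) = (\<Sum>k<e. l k a * a N ^ k)" by blast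
  show ?thesis
  proof (rule exI[of _ e], rule exI[of _ v], rule exI[of _ "T (v(N := 1))"],
      rule exI[of _ "\<lambda>k a. h k a + l k a"], intro conjI allI impI e v)
    show "polyfun N e (\<lambda>a. h k a + l k a)" if "k < e" for k
      by (intro polyfun.add h(1) l(1) that)
    show "g (shear N v a) = T (v(N := 1)) * a N ^ e + (\<Sum>k<e. (h k a + l k a) * a N ^ k)" for a
      by (simp add: TL(4) h(2) l(2) distrib_right sum.distrib)
  qed
qed

section \<open>An effective Nullstellensatz\<close>

text \<open>
  The elements of the ideal generated by \<open>S\<close> that need only multipliers of degree at most \<open>D\<close>. Since
  multiplication raises \<open>D\<close>, this is not an ideal but a layer of a filtration of one.
\<close>

inductive ideal_upto ::
  "nat \<Rightarrow> nat \<Rightarrow> ((nat \<Rightarrow> 'k::comm_ring_1) \<Rightarrow> 'k) set \<Rightarrow> ((nat \<Rightarrow> 'k) \<Rightarrow> 'k) \<Rightarrow> bool"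
  for N D S where
  zero: "ideal_upto N D S (\<lambda>_. 0)"
| step: "f \<in> S \<Longrightarrow> polyfun N D g \<Longrightarrow> ideal_upto N D S h \<Longrightarrow> ideal_upto N D S (\<lambda>a. g a * f a + h a)"

lemma ideal_upto_mono:
  assumes "ideal_upto N D S h" "N \<le> N'" "D \<le> D'"
  shows "ideal_upto N' D' S h"
  using assms(1)
proof (induction rule: ideal_upto.induct)
  case (step f g h)
  show ?case
    by (rule ideal_upto.step[OF step(1) polyfun_mono[OF polyfun_mono_vars[OF step(2)]] step(4)])
      (use assms in auto)
qed (rule ideal_upto.zero)

lemma ideal_upto_add:
  assumes "ideal_upto N D S h" "ideal_upto N D S h'"
  shows "ideal_upto N D S (\<lambda>a. h a + h' a)"
  using assms(1)
proof (induction rule: ideal_upto.induct)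
  case (step f g h)
  then show ?case using ideal_upto.step[OF step(1,2,4)] by (simp add: add.assoc)
qed (simp add: assms(2))

lemma ideal_upto_mult:
  assumes "ideal_upto N D S h" "polyfun N d u"
  shows "ideal_upto N (d + D) S (\<lambda>a. u a * h a)"
  using assms(1)
proof (induction rule: ideal_upto.induct)
  case zero
  show ?case by (simp add: ideal_upto.zero)
next
  case (step f g h)
  show ?case
    using ideal_upto.step[OF step(1) polyfun_mult[OF assms(2) step(2)] step(4)]
    by (simp add: algebra_simps)
qed

lemma ideal_upto_generator: "f \<in> S \<Longrightarrow> polyfun N D g \<Longrightarrow> ideal_upto N D S (\<lambda>a. g a * f a)"
  using ideal_upto.step[OF _ _ ideal_upto.zero] by fastforce

lemma ideal_upto_sum:
  "(\<And>x. x \<in> I \<Longrightarrow> ideal_upto N D S (h x)) \<Longrightarrow> ideal_upto N D S (\<lambda>a. \<Sum>x\<in>I. h x a)"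
  by (induction I rule: infinite_finite_induct) (auto intro: ideal_upto.zero ideal_upto_add)

text \<open>
  Degrees add up when the generators of one certificate are replaced by their own certificates.
\<close>

lemma ideal_upto_trans:
  assumes "ideal_upto N D' S' h" "\<And>f. f \<in> S' \<Longrightarrow> ideal_upto N D S f"
  shows "ideal_upto N (D' + D) S h"
  using assms(1)
proof (induction rule: ideal_upto.induct)
  case (step f g h)
  show ?case by (rule ideal_upto_add[OF ideal_upto_mult[OF assms(2)[OF step(1)] step(2)] step(4)])
qed (rule ideal_upto.zero)

lemma ideal_upto_substitution:
  assumes "ideal_upto N D S h" "\<And>g. polyfun N D g \<Longrightarrow> polyfun N D (\<lambda>a. g (\<phi> a))"
  shows "ideal_upto N D ((\<lambda>f a. f (\<phi> a)) ` S) (\<lambda>a. h (\<phi> a))"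
  using assms(1)
proof (induction rule: ideal_upto.induct)
  case (step f g h)
  show ?case using ideal_upto.step[OF imageI[OF step(1)] assms(2)[OF step(2)] step(4)] by simp
qed (rule ideal_upto.zero)

text \<open>
  Division by \<open>g\<close>, whose leading coefficient \<open>c\<close> is a constant. Multiplying \<open>f\<close> by the last coordinate
  moves the top remainder coefficient to the power \<open>e\<close>, where it is reduced once more; this multiplies it
  by the \<open>h k\<close>, of degree \<open>e\<close>, so that each unit of degree of \<open>f\<close> costs at most \<open>e + 1\<close>.
\<close>

lemma polyfun_division:
  fixes g :: "(nat \<Rightarrow> 'k::field) \<Rightarrow> 'k"
  assumes c: "c \<noteq> 0" and e: "e > 0" and h: "\<And>k. k < e \<Longrightarrow> polyfun N e (h k)"
    and g: "\<And>a. g a = c * a N ^ e + (\<Sum>k<e. h k a * a N ^ k)"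
    and f: "polyfun (Suc N) D f"
  shows "\<exists>q r. polyfun (Suc N) (D * Suc e) q \<and> (\<forall>k<e. polyfun N (D * Suc e) (r k)) \<and>
           (\<forall>a. f a = q a * g a + (\<Sum>k<e. r k a * a N ^ k))"
  using f
proof (induction rule: polyfun.induct)
  case (const D b)
  have "(\<Sum>k<e. (if k = 0 then b else 0) * x ^ k) = b" for x
    using e by (subst sum.remove[of _ 0]) (auto intro!: sum.neutral)
  then show ?case
    by (intro exI[of _ "\<lambda>_. 0"] exI[of _ "\<lambda>k _. if k = 0 then b else 0"])
      (simp add: polyfun.const)
next
  case (var i D f)
  then obtain q r where q: "polyfun (Suc N) (D * Suc e) q"
    and r: "\<And>k. k < e \<Longrightarrow> polyfun N (D * Suc e) (r k)"
    and f: "\<And>a. f a = q a * g a + (\<Sum>k<e. r k a * a N ^ k)" by blast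
  have D1: "Suc (D * Suc e) \<le> Suc D * Suc e" by simp
  show ?case
  proof (cases "i < N")
    case True
    show ?thesis
    proof (rule exI[of _ "\<lambda>a. a i * q a"], rule exI[of _ "\<lambda>k a. a i * r k a"], intro conjI allI impI)
      show "polyfun (Suc N) (Suc D * Suc e) (\<lambda>a. a i * q a)"
        by (rule polyfun_mono[OF polyfun.var[OF var(1) q] D1])
      show "polyfun N (Suc D * Suc e) (\<lambda>a. a i * r k a)" if "k < e" for k
        by (rule polyfun_mono[OF polyfun.var[OF True r[OF that]] D1])
    qed (simp add: f algebra_simps sum_distrib_left)
  next
    case False
    with var(1) have i: "i = N" by simp
    obtain e' where e': "e = Suc e'" using e gr0_implies_Suc by blast
    let ?top = "\<lambda>a. r e' a"
    let ?up = "\<lambda>k. case k of 0 \<Rightarrow> (\<lambda>_. 0) | Suc l \<Rightarrow> r l"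
    let ?q = "\<lambda>a. a N * q a + inverse c * ?top a"
    let ?r = "\<lambda>k a. ?up k a - inverse c * (?top a * h k a)"
    have up: "(\<Sum>k<e. ?up k a * a N ^ k) = (\<Sum>k<e'. r k a * a N ^ Suc k)" for a
      unfolding e' by (subst sum.lessThan_Suc_shift) simp
    have top: "polyfun N (D * Suc e) ?top" by (rule r) (simp add: e')
    show ?thesis
    proof (rule exI[of _ ?q], rule exI[of _ ?r], intro conjI allI impI)
      show "polyfun (Suc N) (Suc D * Suc e) ?q"
        by (intro polyfun.add polyfun_scale polyfun_mono[OF polyfun.var[OF _ q] D1]
            polyfun_mono[OF polyfun_mono_vars[OF top]]) auto
      show "polyfun N (Suc D * Suc e) (?r k)" if "k < e" for k
      proof (intro polyfun_diff polyfun_scale)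
        show "polyfun N (Suc D * Suc e) (?up k)"
        proof (cases k)
          case (Suc l)
          then show ?thesis using that by (auto intro: polyfun_mono[OF r])
        qed (simp add: polyfun.const)
        show "polyfun N (Suc D * Suc e) (\<lambda>a. ?top a * h k a)"
          by (rule polyfun_mono[OF polyfun_mult[OF top h[OF that]]]) simp
      qed
      fix a
      have "(\<Sum>k<e. ?r k a * a N ^ k)
        = (\<Sum>k<e. ?up k a * a N ^ k) - inverse c * ?top a * (\<Sum>k<e. h k a * a N ^ k)"
        by (simp only: left_diff_distrib sum_subtractf sum_distrib_left mult.assoc)
      also have "(\<Sum>k<e. h k a * a N ^ k) = g a - c * a N ^ e" by (simp add: g)
      also have "(\<Sum>k<e. ?up k a * a N ^ k) = a N * (\<Sum>k<e'. r k a * a N ^ k)"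
        unfolding up by (simp add: sum_distrib_left ac_simps)
      finally have "?q a * g a + (\<Sum>k<e. ?r k a * a N ^ k)
        = a N * q a * g a + a N * (\<Sum>k<e'. r k a * a N ^ k) + ?top a * a N ^ e"
        using c by (simp add: field_simps)
      also have "\<dots> = a i * f a"
        unfolding f i e' by (simp add: algebra_simps)
      finally show "a i * f a = ?q a * g a + (\<Sum>k<e. ?r k a * a N ^ k)" ..
    qed
  qed
next
  case (add D f f')
  obtain q r where 1: "polyfun (Suc N) (D * Suc e) q" "\<And>k. k < e \<Longrightarrow> polyfun N (D * Suc e) (r k)"
    "\<And>a. f a = q a * g a + (\<Sum>k<e. r k a * a N ^ k)" using add.IH(1) by blast
  obtain q' r' where 2: "polyfun (Suc N) (D * Suc e) q'" "\<And>k. k < e \<Longrightarrow> polyfun N (D * Suc e) (r' k)"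
    "\<And>a. f' a = q' a * g a + (\<Sum>k<e. r' k a * a N ^ k)" using add.IH(2) by blast
  show ?case
  proof (rule exI[of _ "\<lambda>a. q a + q' a"], rule exI[of _ "\<lambda>k a. r k a + r' k a"],
      intro conjI allI impI)
    show "polyfun (Suc N) (D * Suc e) (\<lambda>a. q a + q' a)" by (intro polyfun.add 1 2)
    show "polyfun N (D * Suc e) (\<lambda>a. r k a + r' k a)" if "k < e" for k
      by (intro polyfun.add 1 2 that)
  qed (simp add: 1(3) 2(3) algebra_simps sum.distrib)
qed

lemma polyfun_det:
  assumes A: "\<And>a. A a \<in> carrier_mat n n"
    and entry: "\<And>i j. i < n \<Longrightarrow> j < n \<Longrightarrow> polyfun N D (\<lambda>a. A a $$ (i, j))"
  shows "polyfun N (n * D) (\<lambda>a. det (A a))"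
proof -
  have "polyfun N (n * D) (\<lambda>a. \<Prod>i = 0..<n. A a $$ (i, p i))" if "p permutes {0..<n}" for p
  proof -
    have "polyfun N (\<Sum>i = 0..<n. D) (\<lambda>a. \<Prod>i = 0..<n. A a $$ (i, p i))"
      using permutes_in_image[OF that] by (intro polyfun_prod entry) auto
    then show ?thesis by simp
  qed
  then show ?thesis
    unfolding det_def'[OF A] by (intro polyfun_sum polyfun_scale) auto
qed

lemma polyfun_cofactor:
  assumes A: "\<And>a. A a \<in> carrier_mat n n"
    and entry: "\<And>i j. i < n \<Longrightarrow> j < n \<Longrightarrow> polyfun N D (\<lambda>a. A a $$ (i, j))"
    and ij: "i < n" "j < n"
  shows "polyfun N ((n - 1) * D) (\<lambda>a. cofactor (A a) i j)"
  unfolding cofactor_def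
proof (rule polyfun_scale, rule polyfun_det)
  show "mat_delete (A a) i j \<in> carrier_mat (n - 1) (n - 1)" for a
    by (rule mat_delete_carrier[OF A])
  fix i' j' assume ij': "i' < n - 1" "j' < n - 1"
  have "mat_delete (A a) i j $$ (i', j')
    = A a $$ (if i' < i then i' else Suc i', if j' < j then j' else Suc j')" for a
    using A[of a] ij' by (simp add: mat_delete_def)
  then show "polyfun N D (\<lambda>a. mat_delete (A a) i j $$ (i', j'))"
    using ij' by (simp add: entry)
qed

text \<open>
  If \<open>F\<close> and \<open>G\<close> have no common root, then \<open>G\<close> divides \<open>U\<close>: a root of \<open>G\<close> must be a root of \<open>U\<close>, and its
  linear factor cancels.
\<close>

lemma common_factor_degree:
  fixes G U F Q :: "'k::alg_closed_field poly"
  assumes "U * F = Q * G" "G \<noteq> 0" "U \<noteq> 0" "\<And>t. poly G t = 0 \<Longrightarrow> poly F t \<noteq> 0"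
  shows "degree G \<le> degree U"
  using assms
proof (induction "degree G" arbitrary: G U)
  case 0
  then show ?case by simp
next
  case (Suc n)
  then obtain t where t: "poly G t = 0"
    using alg_closed_imp_poly_has_root[of G] by auto
  then obtain G' where G': "G = [:-t, 1:] * G'" by (auto simp: poly_eq_0_iff_dvd)
  have "poly U t * poly F t = 0" using Suc.prems(1) t by (metis mult_zero_right poly_mult)
  then have "poly U t = 0" using Suc.prems(4)[OF t] by simp
  then obtain U' where U': "U = [:-t, 1:] * U'" by (auto simp: poly_eq_0_iff_dvd)
  have nz: "G' \<noteq> 0" "U' \<noteq> 0" using Suc.prems G' U' by auto
  have deg: "degree G = Suc (degree G')" "degree U = Suc (degree U')"
    unfolding G' U' using nz by (simp_all add: degree_mult_eq del: mult_pCons_left)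
  have "[:-t, 1:] * (U' * F) = [:-t, 1:] * (Q * G')"
    using Suc.prems(1) unfolding G' U' by (simp only: ac_simps)
  then have "U' * F = Q * G'" by (simp only: mult_cancel_left) auto
  then have "degree G' \<le> degree U'"
    using Suc.hyps(1)[of G' U'] Suc.hyps(2) Suc.prems(4) nz deg G' by auto
  then show ?case using deg by simp
qed

lemma infinite_alg_closed: "infinite (UNIV :: 'k::alg_closed_field set)"
proof
  assume fin: "finite (UNIV :: 'k set)"
  let ?p = "(\<Prod>t\<in>UNIV. [:-t, 1:]) + 1 :: 'k poly"
  have "degree (\<Prod>t\<in>UNIV. [:-t, 1:] :: 'k poly) = card (UNIV :: 'k set)"
    by (subst degree_prod_eq_sum_degree) auto
  then have "degree ?p = card (UNIV :: 'k set)"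
    using fin by (subst degree_add_eq_left) (auto simp: card_gt_0_iff)
  then have "degree ?p > 0" using fin by (simp add: card_gt_0_iff)
  then obtain x where "poly ?p x = 0" using alg_closed_imp_poly_has_root by blast
  moreover have "poly (\<Prod>t\<in>UNIV. [:-t, 1:]) x = 0"
    using fin by (auto simp: poly_prod)
  ultimately show False by simp
qed

text \<open>
  A single combination with constant multipliers avoids finitely many points, since at every point only
  finitely many values of a new multiplier are bad.
\<close>

lemma generic_combination:
  fixes S :: "((nat \<Rightarrow> 'k::field) \<Rightarrow> 'k) set"
  assumes inf: "infinite (UNIV :: 'k set)" and "finite P"
    and "\<And>f. f \<in> S \<Longrightarrow> polyfun N d f" and "\<And>b. b \<in> P \<Longrightarrow> \<exists>f\<in>S. f b \<noteq> 0"
  shows "\<exists>F. polyfun N d F \<and> ideal_upto N 0 S F \<and> (\<forall>b\<in>P. F b \<noteq> 0)"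
  using assms(2,4)
proof (induction P rule: finite_induct)
  case empty
  show ?case by (intro exI[of _ "\<lambda>_. 0"]) (auto intro: polyfun.const ideal_upto.zero)
next
  case (insert b P)
  then obtain F where F: "polyfun N d F" "ideal_upto N 0 S F" "\<And>b. b \<in> P \<Longrightarrow> F b \<noteq> 0" by auto
  obtain f where f: "f \<in> S" "f b \<noteq> 0" using insert.prems by blast
  \<comment> \<open>where \<open>f x = 0\<close> no multiplier is bad; the quotient is then the harmless value \<open>0\<close>\<close>
  let ?bad = "(\<lambda>x. - F x / f x) ` insert b P"
  have "finite ?bad" using insert.hyps by simp
  then obtain l where l: "l \<notin> ?bad" using inf ex_new_if_finite by blast
  let ?F = "\<lambda>a. F a + l * f a"
  have nz: "?F x \<noteq> 0" if x: "x \<in> insert b P" for x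
  proof (cases "f x = 0")
    case True
    then show ?thesis using x f(2) F(3) by auto
  next
    case False
    have "l \<noteq> - F x / f x" using l x by blast
    then show ?thesis using False by (auto simp: field_simps add_eq_0_iff)
  qed
  have poly: "polyfun N d ?F" by (intro polyfun.add polyfun_scale F assms(3) f)
  have ideal: "ideal_upto N 0 S ?F"
    by (rule ideal_upto_add[OF F(2) ideal_upto_generator[OF f(1) polyfun.const]])
  show ?case by (rule exI[of _ ?F]) (use nz poly ideal in blast)
qed

lemma poly_eq_if_eq_everywhere:
  fixes p q :: "'k::idom poly"
  assumes "infinite (UNIV :: 'k set)" "\<And>t. poly p t = poly q t"
  shows "p = q"
proof (rule ccontr)
  assume "p \<noteq> q"
  then have "finite {t. poly (p - q) t = 0}" by (intro poly_roots_finite) simp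
  then show False using assms by simp
qed

text \<open>
  The degree of a determinant of size at most \<open>d\<close> whose entries have degree at most \<open>2 d (d + 1)\<close>, the
  bound of \<open>polyfun_division\<close> for the remainders of polynomials of degree \<open>2 d\<close>.
\<close>

definition elimination_degree :: "nat \<Rightarrow> nat" where
  "elimination_degree d = d * (2 * d * Suc d)"

text \<open>
  Let \<open>F\<close> be a combination of \<open>S\<close> that vanishes at no zero of \<open>g\<close> on the line through \<open>b\<close>. The matrix \<open>A\<close>
  describes multiplication by \<open>F\<close> modulo \<open>g\<close> in the basis of powers of the last coordinate, and \<open>R\<close> is its
  determinant, the norm of \<open>F\<close>. Multiplying the relations that define \<open>A\<close> by the first row of cofactors
  exhibits \<open>R\<close> as a combination of \<open>F\<close> and \<open>g\<close>. If \<open>R\<close> vanished at \<open>b\<close>, a kernel vector of \<open>A\<close> would be a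
  polynomial \<open>U\<close> of degree less than \<open>e\<close> such that \<open>g\<close> divides \<open>U F\<close> on this line, although \<open>g\<close> and \<open>F\<close> have
  no common root there.
\<close>

lemma eliminate_last_variable:
  fixes S :: "((nat \<Rightarrow> 'k::alg_closed_field) \<Rightarrow> 'k) set"
  assumes S: "\<And>f. f \<in> S \<Longrightarrow> polyfun (Suc N) d f"
    and no_zero: "\<And>a. \<exists>f\<in>S. f a \<noteq> 0"
    and gS: "g \<in> S" and c: "c \<noteq> 0" and e: "0 < e" "e \<le> d"
    and h: "\<And>k. k < e \<Longrightarrow> polyfun N e (h k)"
    and g: "\<And>a. g a = c * a N ^ e + (\<Sum>k<e. h k a * a N ^ k)"
  shows "\<exists>R. polyfun N (elimination_degree d) R \<and>
             ideal_upto (Suc N) (elimination_degree d) S R \<and> R b \<noteq> 0"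
proof -
  note inf = infinite_alg_closed[where 'k = 'k]
  define G where "G = monom c e + (\<Sum>k<e. monom (h k b) k)"
  have h_upd: "h k (b(N := t)) = h k b" if "k < e" for k t
    by (rule polyfun_cong_point[OF h[OF that]]) auto
  have G: "poly G t = g (b(N := t))" for t
    by (simp add: G_def g poly_sum poly_monom h_upd)
  have degG: "degree G = e"
  proof -
    have "degree (\<Sum>k<e. monom (h k b) k) \<le> e - 1"
      by (intro degree_sum_le) (auto intro: order.trans[OF degree_monom_le])
    then have "degree (\<Sum>k<e. monom (h k b) k) < degree (monom c e)"
      using e c by (simp add: degree_monom_eq)
    then show ?thesis unfolding G_def using c by (simp add: degree_add_eq_left degree_monom_eq)
  qed
  then have G0: "G \<noteq> 0" using e by auto
  \<comment> \<open>the finitely many zeros of \<open>g\<close> on the line through \<open>b\<close>\<close>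
  let ?P = "(\<lambda>t. b(N := t)) ` {t. poly G t = 0}"
  have "finite ?P" using poly_roots_finite[OF G0] by simp
  from generic_combination[OF inf this S no_zero] obtain F where
    F: "polyfun (Suc N) d F" "ideal_upto (Suc N) 0 S F" "\<And>x. x \<in> ?P \<Longrightarrow> F x \<noteq> 0" by blast
  define M where "M = 2 * d * Suc d"
  let ?div = "\<lambda>j q r. polyfun (Suc N) M q \<and> (\<forall>k<e. polyfun N M (r k)) \<and>
           (\<forall>a. a N ^ j * F a = q a * g a + (\<Sum>k<e. r k a * a N ^ k))"
  have "\<exists>q r. ?div j q r" if j: "j < e" for j
  proof -
    have "polyfun (Suc N) (j * 1) (\<lambda>a. a N ^ j)" by (intro polyfun_power polyfun_coord) auto
    from polyfun_mult[OF this F(1)] have "polyfun (Suc N) (2 * d) (\<lambda>a. a N ^ j * F a)"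
      by (rule polyfun_mono) (use j e in simp)
    from polyfun_division[OF c e(1) h g this]
    obtain q r where qr: "polyfun (Suc N) (2 * d * Suc e) q"
      "\<forall>k<e. polyfun N (2 * d * Suc e) (r k)"
      "\<forall>a. a N ^ j * F a = q a * g a + (\<Sum>k<e. r k a * a N ^ k)" by blast
    have "2 * d * Suc e \<le> M" unfolding M_def using e by (intro mult_le_mono) auto
    then show ?thesis using qr polyfun_mono by blast
  qed
  then have "\<forall>j. \<exists>q r. j < e \<longrightarrow> ?div j q r" by blast
  from choice[OF this] obtain q where "\<forall>j. \<exists>r. j < e \<longrightarrow> ?div j (q j) r" by blast
  from choice[OF this] obtain r where div: "\<And>j. j < e \<Longrightarrow> ?div j (q j) (r j)" by blast
  have q: "polyfun (Suc N) M (q j)" if "j < e" for j using div[OF that] by blast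
  have r: "polyfun N M (r j k)" if "j < e" "k < e" for j k using div[OF that(1)] that(2) by blast
  have qr: "a N ^ j * F a = q j a * g a + (\<Sum>k<e. r j k a * a N ^ k)" if "j < e" for j a
    using div[OF that] by blast
  \<comment> \<open>column \<open>j\<close> contains the remainder of \<open>F\<close> times the \<open>j\<close>-th power of the last coordinate\<close>
  define A where "A = (\<lambda>a. mat e e (\<lambda>(k, j). r j k a))"
  have A: "A a \<in> carrier_mat e e" for a by (simp add: A_def)
  have entry: "polyfun N M (\<lambda>a. A a $$ (k, j))" if "k < e" "j < e" for k j
    using that by (simp add: A_def r)
  define R where "R = (\<lambda>a. det (A a))"
  have deg_le: "e * M \<le> elimination_degree d"
    unfolding elimination_degree_def M_def using e by (intro mult_le_mono) auto
  have R: "polyfun N (elimination_degree d) R"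
    unfolding R_def by (rule polyfun_mono[OF polyfun_det[OF A entry] deg_le])
  let ?C = "\<lambda>j a. cofactor (A a) 0 j"
  have C: "polyfun N ((e - 1) * M) (?C j)" if "j < e" for j
    using polyfun_cofactor[OF A entry e(1) that] by simp
  have R_eq: "R a = (\<Sum>j<e. (?C j a * a N ^ j) * F a + (- (?C j a * q j a)) * g a)" for a
  proof -
    have adj: "(\<Sum>j<e. r j k a * ?C j a) = (if k = 0 then R a else 0)" if k: "k < e" for k
    proof -
      have "(A a * adj_mat (A a)) $$ (k, 0) = (\<Sum>j<e. r j k a * ?C j a)"
        using k e A[of a] adj_mat(1)[OF A[of a]]
        by (simp add: scalar_prod_def adj_mat_def A_def atLeast0LessThan)
      then show ?thesis
        unfolding adj_mat(2)[OF A[of a]] R_def using k e A[of a] by auto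
    qed
    have "(\<Sum>j<e. (?C j a * a N ^ j) * F a + (- (?C j a * q j a)) * g a)
      = (\<Sum>j<e. ?C j a * (\<Sum>k<e. r j k a * a N ^ k))"
    proof (rule sum.cong[OF refl])
      fix j assume "j \<in> {..<e}"
      then have remainder: "(\<Sum>k<e. r j k a * a N ^ k) = a N ^ j * F a - q j a * g a"
        by (simp add: qr)
      show "(?C j a * a N ^ j) * F a + (- (?C j a * q j a)) * g a
        = ?C j a * (\<Sum>k<e. r j k a * a N ^ k)"
        unfolding remainder by (simp add: algebra_simps)
    qed
    also have "\<dots> = (\<Sum>k<e. (\<Sum>j<e. r j k a * ?C j a) * a N ^ k)"
      unfolding sum_distrib_left sum_distrib_right by (subst sum.swap) (simp add: ac_simps)
    also have "\<dots> = (\<Sum>k<e. if k = 0 then R a else 0)"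
      by (intro sum.cong) (auto simp: adj)
    also have "\<dots> = R a" using e by (simp add: sum.delta)
    finally show ?thesis ..
  qed
  have "ideal_upto (Suc N) (elimination_degree d) S
     (\<lambda>a. \<Sum>j<e. (?C j a * a N ^ j) * F a + (- (?C j a * q j a)) * g a)"
  proof (intro ideal_upto_sum ideal_upto_add)
    fix j assume "j \<in> {..<e}"
    then have j: "j < e" by simp
    have "e \<le> M" using e unfolding M_def by simp
    moreover have "(e - 1) * M + M = e * M" using e by (cases e) auto
    ultimately have deg: "(e - 1) * M + j \<le> elimination_degree d" "(e - 1) * M + M \<le> elimination_degree d"
      using deg_le j by auto
    have Cj: "polyfun (Suc N) ((e - 1) * M) (?C j)" by (rule polyfun_mono_vars[OF C[OF j]]) simp
    have "polyfun (Suc N) (j * 1) (\<lambda>a. a N ^ j)" by (intro polyfun_power polyfun_coord) auto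
    then have "polyfun (Suc N) ((e - 1) * M + j) (\<lambda>a. ?C j a * a N ^ j)"
      using polyfun_mult[OF Cj] by simp
    from ideal_upto_mult[OF F(2) this]
    show "ideal_upto (Suc N) (elimination_degree d) S (\<lambda>a. (?C j a * a N ^ j) * F a)"
      by (rule ideal_upto_mono) (use deg in auto)
    show "ideal_upto (Suc N) (elimination_degree d) S (\<lambda>a. (- (?C j a * q j a)) * g a)"
      by (rule ideal_upto_generator[OF gS], rule polyfun_minus,
          rule polyfun_mono[OF polyfun_mult[OF Cj q[OF j]] deg(2)])
  qed
  then have ideal: "ideal_upto (Suc N) (elimination_degree d) S R"
    by (simp only: R_eq[symmetric])
  \<comment> \<open>a kernel vector of \<open>A b\<close> is the list of coefficients of the polynomial \<open>U\<close>\<close>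
  have "R b \<noteq> 0"
  proof
    assume "R b = 0"
    then obtain v where v: "v \<in> carrier_vec e" "v \<noteq> 0\<^sub>v e" "A b *\<^sub>v v = 0\<^sub>v e"
      unfolding R_def using det_0_iff_vec_prod_zero[OF A] by blast
    have kernel: "(\<Sum>j<e. r j k b * vec_index v j) = 0" if k: "k < e" for k
    proof -
      have "vec_index (A b *\<^sub>v v) k = (\<Sum>j<e. r j k b * vec_index v j)"
        using k v(1) by (simp add: A_def scalar_prod_def atLeast0LessThan)
      then show ?thesis using v(3) k by simp
    qed
    define U where "U = (\<Sum>j<e. monom (vec_index v j) j)"
    have coeffU: "coeff U j = vec_index v j" if "j < e" for j
      using that by (simp add: U_def coeff_sum)
    have "U \<noteq> 0"
    proof
      assume "U = 0"
      then have "vec_index v j = 0" if "j < e" for j using coeffU[OF that] by simp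
      then show False using v(1,2) by (metis eq_vecI carrier_vecD dim_vec index_zero_vec)
    qed
    have degU: "degree U < e"
    proof -
      have "degree U \<le> e - 1" unfolding U_def
        by (intro degree_sum_le) (auto intro: order.trans[OF degree_monom_le])
      then show ?thesis using e by simp
    qed
    obtain FP where FP: "\<And>t. F (b(N := t)) = poly FP t"
      by (rule polyfun_univariate[OF F(1)]) blast
    have "\<exists>p. \<forall>t. q j (b(N := t)) = poly p t" if "j < e" for j
      by (rule polyfun_univariate[OF q[OF that]]) blast
    then have "\<forall>j. \<exists>p. j < e \<longrightarrow> (\<forall>t. q j (b(N := t)) = poly p t)" by blast
    from choice[OF this] obtain QP where QP: "\<And>j t. j < e \<Longrightarrow> q j (b(N := t)) = poly (QP j) t"
      by blast
    define Q where "Q = (\<Sum>j<e. Polynomial.smult (vec_index v j) (QP j))"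
    have "poly (U * FP) t = poly (Q * G) t" for t
    proof -
      let ?b = "b(N := t)"
      have r_upd: "r j k ?b = r j k b" if "j < e" "k < e" for j k
        by (rule polyfun_cong_point[OF r[OF that]]) auto
      have "poly (U * FP) t = (\<Sum>j<e. vec_index v j * (t ^ j * F ?b))"
        by (simp add: U_def poly_sum poly_monom FP sum_distrib_right mult.assoc)
      also have "\<dots> = (\<Sum>j<e. vec_index v j * (q j ?b * g ?b) + vec_index v j * (\<Sum>k<e. r j k b * t ^ k))"
      proof (rule sum.cong[OF refl])
        fix j assume j: "j \<in> {..<e}"
        then have "t ^ j * F ?b = q j ?b * g ?b + (\<Sum>k<e. r j k b * t ^ k)"
          using qr[of j ?b] by (simp add: r_upd)
        then show "vec_index v j * (t ^ j * F ?b)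
          = vec_index v j * (q j ?b * g ?b) + vec_index v j * (\<Sum>k<e. r j k b * t ^ k)"
          by (simp add: distrib_left)
      qed
      also have "\<dots> = (\<Sum>j<e. vec_index v j * (q j ?b * g ?b)) + (\<Sum>j<e. vec_index v j * (\<Sum>k<e. r j k b * t ^ k))"
        by (rule sum.distrib)
      also have "(\<Sum>j<e. vec_index v j * (\<Sum>k<e. r j k b * t ^ k)) = (\<Sum>k<e. (\<Sum>j<e. r j k b * vec_index v j) * t ^ k)"
        unfolding sum_distrib_left sum_distrib_right by (subst sum.swap) (simp add: ac_simps)
      also have "\<dots> = 0" by (simp add: kernel)
      also have "(\<Sum>j<e. vec_index v j * (q j ?b * g ?b)) = poly (Q * G) t"
        by (simp add: Q_def poly_sum QP G sum_distrib_right mult.assoc)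
      finally show ?thesis by simp
    qed
    then have "U * FP = Q * G" by (rule poly_eq_if_eq_everywhere[OF inf])
    then have "degree G \<le> degree U"
      by (rule common_factor_degree[OF _ G0 \<open>U \<noteq> 0\<close>]) (use F(3) FP in fastforce)
    then show False using degG degU by simp
  qed
  then show ?thesis using R ideal by blast
qed

fun nullstellensatz_degree :: "nat \<Rightarrow> nat \<Rightarrow> nat" where
  "nullstellensatz_degree 0 d = 0"
| "nullstellensatz_degree (Suc N) d =
     nullstellensatz_degree N (elimination_degree d) + elimination_degree d"

text \<open>
  The members of the ideal that \<open>eliminate_last_variable\<close> provides for the various points \<open>b\<close> again have
  no common zero, and they involve one variable less. They form an infinite set in general, so the
  induction is over all sets \<open>S\<close> of bounded degree.
\<close>

theorem effective_nullstellensatz: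
  fixes S :: "((nat \<Rightarrow> 'k::alg_closed_field) \<Rightarrow> 'k) set"
  assumes "\<And>f. f \<in> S \<Longrightarrow> polyfun N d f" and "\<And>a. \<exists>f\<in>S. f a \<noteq> 0"
  shows "ideal_upto N (nullstellensatz_degree N d) S (\<lambda>_. 1)"
  using assms
proof (induction N arbitrary: d S)
  case 0
  obtain f where f: "f \<in> S" "f (\<lambda>_. 0) \<noteq> 0" using "0.prems"(2) by blast
  have const: "f a = f (\<lambda>_. 0)" for a by (rule polyfun_cong_point[OF "0.prems"(1)[OF f(1)]]) auto
  have "ideal_upto 0 0 S (\<lambda>a. inverse (f (\<lambda>_. 0)) * f a)"
    by (rule ideal_upto_generator[OF f(1) polyfun.const])
  also have "(\<lambda>a. inverse (f (\<lambda>_. 0)) * f a) = (\<lambda>_. 1)"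
    by (rule ext, subst const) (use f(2) in simp)
  finally show ?case by simp
next
  case (Suc N)
  let ?D = "nullstellensatz_degree (Suc N) d"
  obtain g0 where g0: "g0 \<in> S" "g0 (\<lambda>_. 0) \<noteq> 0" using Suc.prems(2) by blast
  from polyfun_monic_after_shear[OF infinite_alg_closed Suc.prems(1)[OF g0(1)] g0(2)]
  obtain e v c h where e: "e \<le> d" and c: "c \<noteq> 0" and h': "\<forall>k<e. polyfun N e (h k)"
    and g': "\<forall>a. g0 (shear N v a) = c * a N ^ e + (\<Sum>k<e. h k a * a N ^ k)"
    by (elim exE conjE) (rule that)
  have h: "polyfun N e (h k)" if "k < e" for k using h' that by blast
  have g: "g0 (shear N v a) = c * a N ^ e + (\<Sum>k<e. h k a * a N ^ k)" for a using g' by blast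
  let ?back = "shear N (\<lambda>i. - v i)"
  define S' where "S' = (\<lambda>f a. f (shear N v a)) ` S"
  have S': "polyfun (Suc N) d f" if "f \<in> S'" for f
    using that Suc.prems(1) by (auto simp: S'_def intro: polyfun_shear)
  have no_zero: "\<exists>f\<in>S'. f a \<noteq> 0" for a
    using Suc.prems(2)[of "shear N v a"] by (auto simp: S'_def)
  have gS': "(\<lambda>a. g0 (shear N v a)) \<in> S'" using g0(1) by (auto simp: S'_def)
  have one: "ideal_upto (Suc N) ?D S' (\<lambda>_. 1)"
  proof (cases "e = 0")
    case True
    have "ideal_upto (Suc N) ?D S' (\<lambda>a. inverse c * g0 (shear N v a))"
      by (rule ideal_upto_generator[OF gS' polyfun.const])
    then show ?thesis using True c by (simp add: g)
  next
    case False
    then have e0: "0 < e" by simp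
    let ?d = "elimination_degree d"
    define H where "H = {R. polyfun N ?d R \<and> ideal_upto (Suc N) ?d S' R}"
    have "ideal_upto N (nullstellensatz_degree N ?d) H (\<lambda>_. 1)"
    proof (rule Suc.IH)
      show "polyfun N ?d f" if "f \<in> H" for f using that by (simp add: H_def)
      show "\<exists>f\<in>H. f a \<noteq> 0" for a
        using eliminate_last_variable[OF S' no_zero gS' c e0 e h g] by (auto simp: H_def)
    qed
    then have "ideal_upto (Suc N) (nullstellensatz_degree N ?d) H (\<lambda>_. 1)"
      by (rule ideal_upto_mono) auto
    from ideal_upto_trans[OF this] show ?thesis by (simp add: H_def)
  qed
  have "(\<lambda>f a. f (?back a)) ` S' = S"
    unfolding S'_def image_image by (simp add: shear_inverse)
  moreover have "ideal_upto (Suc N) ?D ((\<lambda>f a. f (?back a)) ` S') (\<lambda>_. 1)"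
    by (rule ideal_upto_substitution[OF one polyfun_shear])
  ultimately show ?case by simp
qed

section \<open>Linear systems over two fields\<close>

lemma nontrivial_kernel:
  fixes A :: "'r \<Rightarrow> 'c \<Rightarrow> 'k::field"
  assumes "finite I" "finite J" "card I < card J"
  shows "\<exists>y. (\<exists>c\<in>J. y c \<noteq> 0) \<and> (\<forall>\<rho>\<in>I. (\<Sum>c\<in>J. A \<rho> c * y c) = 0)"
  using assms
proof (induction I arbitrary: A J rule: finite_induct)
  case empty
  then obtain c where "c \<in> J" by fastforce
  then show ?case by (intro exI[of _ "\<lambda>_. 1"]) auto
next
  case (insert \<rho> I)
  show ?case
  proof (cases "\<forall>c\<in>J. A \<rho> c = 0")
    case True
    have "card I < card J" using insert by simp
    from insert.IH[OF insert.prems(1) this] obtain y where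
      "\<exists>c\<in>J. y c \<noteq> 0" "\<forall>\<rho>\<in>I. (\<Sum>c\<in>J. A \<rho> c * y c) = 0" by blast
    then show ?thesis using True by (intro exI[of _ y]) auto
  next
    case False
    then obtain c0 where c0: "c0 \<in> J" "A \<rho> c0 \<noteq> 0" by blast
    \<comment> \<open>use row \<open>\<rho>\<close> to eliminate the unknown \<open>c0\<close>\<close>
    let ?J = "J - {c0}"
    let ?B = "\<lambda>\<sigma> c. A \<sigma> c - A \<sigma> c0 / A \<rho> c0 * A \<rho> c"
    have "card I < card ?J" using insert c0 by simp
    with insert.IH[of ?J ?B] insert.prems obtain y where
      y: "\<exists>c\<in>?J. y c \<noteq> 0" "\<forall>\<sigma>\<in>I. (\<Sum>c\<in>?J. ?B \<sigma> c * y c) = 0" by blast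
    let ?s = "\<lambda>\<sigma>. \<Sum>c\<in>?J. A \<sigma> c * y c"
    define z where "z = y(c0 := - ?s \<rho> / A \<rho> c0)"
    have z: "(\<Sum>c\<in>J. A \<sigma> c * z c) = ?s \<sigma> - A \<sigma> c0 / A \<rho> c0 * ?s \<rho>" for \<sigma>
    proof -
      have "(\<Sum>c\<in>J. A \<sigma> c * z c) = A \<sigma> c0 * z c0 + (\<Sum>c\<in>?J. A \<sigma> c * z c)"
        using insert.prems(1) c0(1) by (rule sum.remove)
      also have "(\<Sum>c\<in>?J. A \<sigma> c * z c) = ?s \<sigma>" by (intro sum.cong) (auto simp: z_def)
      finally show ?thesis by (simp add: z_def)
    qed
    have "(\<Sum>c\<in>?J. ?B \<sigma> c * y c) = ?s \<sigma> - A \<sigma> c0 / A \<rho> c0 * ?s \<rho>" for \<sigma>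
      by (simp add: left_diff_distrib sum_subtractf sum_distrib_left mult.assoc)
    then have "\<forall>\<sigma>\<in>insert \<rho> I. (\<Sum>c\<in>J. A \<sigma> c * z c) = 0"
      using y(2) c0(2) by (simp add: z)
    moreover have "\<exists>c\<in>J. z c \<noteq> 0" using y(1) by (auto simp: z_def)
    ultimately show ?thesis by blast
  qed
qed

definition solves ::
  "'r set \<Rightarrow> 'c set \<Rightarrow> ('r \<Rightarrow> 'c \<Rightarrow> int) \<Rightarrow> ('r \<Rightarrow> int) \<Rightarrow> ('c \<Rightarrow> 'k::comm_ring_1) \<Rightarrow> bool" where
  "solves Rows C A b x \<longleftrightarrow> (\<forall>\<rho>\<in>Rows. (\<Sum>c\<in>C. of_int (A \<rho> c) * x c) = of_int (b \<rho>))"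

text \<open>
  Take a solution of minimal support: a linear relation between its columns could be used to shrink it.
\<close>

lemma solution_on_independent_columns:
  fixes A :: "'r \<Rightarrow> 'c \<Rightarrow> 'k::field"
  assumes "finite C" and "\<forall>\<rho>\<in>Rows. (\<Sum>c\<in>C. A \<rho> c * x c) = b \<rho>"
  shows "\<exists>J x. J \<subseteq> C \<and> (\<forall>\<rho>\<in>Rows. (\<Sum>c\<in>J. A \<rho> c * x c) = b \<rho>) \<and>
     (\<forall>y. (\<forall>\<rho>\<in>Rows. (\<Sum>c\<in>J. A \<rho> c * y c) = 0) \<longrightarrow> (\<forall>c\<in>J. y c = 0))"
  using assms
proof (induction "card C" arbitrary: C x rule: less_induct)
  case less
  show ?case
  proof (cases "\<forall>y. (\<forall>\<rho>\<in>Rows. (\<Sum>c\<in>C. A \<rho> c * y c) = 0) \<longrightarrow> (\<forall>c\<in>C. y c = 0)")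
    case True
    then show ?thesis using less.prems(2) by blast
  next
    case False
    then obtain y c0 where y: "\<And>\<rho>. \<rho> \<in> Rows \<Longrightarrow> (\<Sum>c\<in>C. A \<rho> c * y c) = 0" and c0: "c0 \<in> C" "y c0 \<noteq> 0"
      by blast
    let ?l = "x c0 / y c0"
    let ?x = "\<lambda>c. x c - ?l * y c"
    have "(\<Sum>c\<in>C - {c0}. A \<rho> c * ?x c) = b \<rho>" if \<rho>: "\<rho> \<in> Rows" for \<rho>
    proof -
      have "(\<Sum>c\<in>C. A \<rho> c * ?x c) = A \<rho> c0 * ?x c0 + (\<Sum>c\<in>C - {c0}. A \<rho> c * ?x c)"
        by (rule sum.remove[OF less.prems(1) c0(1)])
      also have "?x c0 = 0" using c0(2) by simp
      finally have "(\<Sum>c\<in>C - {c0}. A \<rho> c * ?x c) = (\<Sum>c\<in>C. A \<rho> c * ?x c)" by simp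
      also have "\<dots> = (\<Sum>c\<in>C. A \<rho> c * x c) - ?l * (\<Sum>c\<in>C. A \<rho> c * y c)"
        by (simp only: right_diff_distrib sum_subtractf sum_distrib_left mult.left_commute)
      finally show ?thesis using less.prems(2) y[OF \<rho>] \<rho> by simp
    qed
    then have x': "\<forall>\<rho>\<in>Rows. (\<Sum>c\<in>C - {c0}. A \<rho> c * ?x c) = b \<rho>" by blast
    have "card (C - {c0}) < card C" by (rule card_Diff1_less[OF less.prems(1) c0(1)])
    from less.hyps[OF this finite_Diff[OF less.prems(1)] x'] obtain J z where J: "J \<subseteq> C - {c0}"
      and z: "\<forall>\<rho>\<in>Rows. (\<Sum>c\<in>J. A \<rho> c * z c) = b \<rho>"
        "\<forall>y. (\<forall>\<rho>\<in>Rows. (\<Sum>c\<in>J. A \<rho> c * y c) = 0) \<longrightarrow> (\<forall>c\<in>J. y c = 0)"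
      by (elim exE conjE) (rule that)
    from J have "J \<subseteq> C" by blast
    then show ?thesis using z by (intro exI[of _ J] exI[of _ z] conjI)
  qed
qed

text \<open>
  More rows than independent columns are dependent, and a row that is a combination of the others can be
  dropped without creating a new kernel vector.
\<close>

lemma square_subsystem:
  fixes A :: "'r \<Rightarrow> 'c \<Rightarrow> 'k::field"
  assumes "finite Rows" "finite J"
    and "\<forall>y. (\<forall>\<rho>\<in>Rows. (\<Sum>c\<in>J. A \<rho> c * y c) = 0) \<longrightarrow> (\<forall>c\<in>J. y c = 0)"
  shows "\<exists>I \<subseteq> Rows. card I = card J \<and>
     (\<forall>y. (\<forall>\<rho>\<in>I. (\<Sum>c\<in>J. A \<rho> c * y c) = 0) \<longrightarrow> (\<forall>c\<in>J. y c = 0))"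
  using assms(1,3)
proof (induction "card Rows" arbitrary: Rows rule: less_induct)
  case less
  have "\<not> card Rows < card J" 
  proof
    assume "card Rows < card J"
    from nontrivial_kernel[OF less.prems(1) assms(2) this, of A] less.prems(2) show False by blast
  qed
  then consider "card Rows = card J" | "card J < card Rows" by linarith
  then show ?case
  proof cases
    case 1
    then show ?thesis using less.prems(2) by blast
  next
    case 2
    \<comment> \<open>the rows are dependent, so that one of them can be dropped\<close>
    from nontrivial_kernel[OF assms(2) less.prems(1) 2, of "\<lambda>c \<rho>. A \<rho> c"]
    obtain w \<rho>0 where w: "\<And>c. c \<in> J \<Longrightarrow> (\<Sum>\<rho>\<in>Rows. A \<rho> c * w \<rho>) = 0" and \<rho>0: "\<rho>0 \<in> Rows" "w \<rho>0 \<noteq> 0"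
      by blast
    have indep: "\<forall>c\<in>J. y c = 0" if y: "\<forall>\<rho>\<in>Rows - {\<rho>0}. (\<Sum>c\<in>J. A \<rho> c * y c) = 0" for y
    proof -
      let ?s = "\<lambda>\<rho>. \<Sum>c\<in>J. A \<rho> c * y c"
      have "w \<rho>0 * ?s \<rho>0 = w \<rho>0 * ?s \<rho>0 + (\<Sum>\<rho>\<in>Rows - {\<rho>0}. w \<rho> * ?s \<rho>)" by (simp add: y)
      also have "\<dots> = (\<Sum>\<rho>\<in>Rows. w \<rho> * ?s \<rho>)"
        by (rule sum.remove[OF less.prems(1) \<rho>0(1), symmetric])
      also have "\<dots> = (\<Sum>c\<in>J. (\<Sum>\<rho>\<in>Rows. A \<rho> c * w \<rho>) * y c)"
        unfolding sum_distrib_left sum_distrib_right by (subst sum.swap) (simp add: ac_simps)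
      also have "\<dots> = 0" by (simp add: w)
      finally have "?s \<rho>0 = 0" using \<rho>0(2) by simp
      with y have "\<forall>\<rho>\<in>Rows. ?s \<rho> = 0" by blast
      then show ?thesis using less.prems(2) by blast
    qed
    have "card (Rows - {\<rho>0}) < card Rows" by (rule card_Diff1_less[OF less.prems(1) \<rho>0(1)])
    moreover have "finite (Rows - {\<rho>0})" using less.prems(1) by simp
    moreover have "\<forall>y. (\<forall>\<rho>\<in>Rows - {\<rho>0}. (\<Sum>c\<in>J. A \<rho> c * y c) = 0) \<longrightarrow> (\<forall>c\<in>J. y c = 0)"
      using indep by blast
    ultimately have "\<exists>I\<subseteq>Rows - {\<rho>0}. card I = card J \<and>
      (\<forall>y. (\<forall>\<rho>\<in>I. (\<Sum>c\<in>J. A \<rho> c * y c) = 0) \<longrightarrow> (\<forall>c\<in>J. y c = 0))"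
      by (rule less.hyps)
    then show ?thesis by blast
  qed
qed

lemma abs_det_le:
  fixes M :: "int mat"
  assumes M: "M \<in> carrier_mat k k" and bound: "\<And>i j. i < k \<Longrightarrow> j < k \<Longrightarrow> \<bar>M $$ (i, j)\<bar> \<le> H"
  shows "\<bar>det M\<bar> \<le> fact k * H ^ k"
proof -
  have "\<bar>det M\<bar> \<le> (\<Sum>p | p permutes {0..<k}. \<bar>signof p * (\<Prod>i = 0..<k. M $$ (i, p i))\<bar>)"
    unfolding det_def'[OF M] by (rule sum_abs)
  also have "\<dots> \<le> (\<Sum>p | p permutes {0..<k}. H ^ k)"
  proof (rule sum_mono)
    fix p assume "p \<in> {p. p permutes {0..<k}}"
    then have p: "p permutes {0..<k}" by simp
    have "(\<Prod>i = 0..<k. \<bar>M $$ (i, p i)\<bar>) \<le> (\<Prod>i = 0..<k. H)"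
      using permutes_in_image[OF p] by (intro prod_mono) (auto intro: bound)
    then show "\<bar>signof p * (\<Prod>i = 0..<k. M $$ (i, p i))\<bar> \<le> H ^ k"
      by (simp add: abs_mult abs_prod sign_def)
  qed
  also have "\<dots> = fact k * H ^ k" by (simp add: card_permutations)
  finally show ?thesis .
qed

text \<open>
  Independent columns \<open>J\<close> and as many rows \<open>I\<close> single out a minor \<open>d\<close> that is not zero in the first field.
  Cramer's rule on these rows produces integers \<open>u\<close> that solve the system with right-hand side \<open>d b\<close> in
  that field. The defect of every equation is an integer of absolute value at most \<open>B\<close>, hence is zero, and
  the system is solved by \<open>u / d\<close> in every field in which \<open>d\<close> does not vanish.
\<close>

lemma linear_system_transfer:
  fixes A :: "'r \<Rightarrow> 'c \<Rightarrow> int" and x :: "'c \<Rightarrow> 'k::field"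
  assumes "finite Rows" "finite C" and H: "1 \<le> H"
    and AH: "\<And>\<rho> c. \<rho> \<in> Rows \<Longrightarrow> c \<in> C \<Longrightarrow> \<bar>A \<rho> c\<bar> \<le> H" and bH: "\<And>\<rho>. \<rho> \<in> Rows \<Longrightarrow> \<bar>b \<rho>\<bar> \<le> H"
    and B: "B = fact (card C + 1) * H ^ (card C + 1)"
    and K: "\<And>t. \<bar>t\<bar> \<le> B \<Longrightarrow> (of_int t :: 'k) = 0 \<Longrightarrow> t = 0"
    and L: "\<And>t. \<bar>t\<bar> \<le> B \<Longrightarrow> (of_int t :: 'l::field) = 0 \<Longrightarrow> t = 0"
    and x: "solves Rows C A b x"
  shows "\<exists>y :: 'c \<Rightarrow> 'l. solves Rows C A b y"
proof -
  let ?A = "\<lambda>\<rho> c. of_int (A \<rho> c) :: 'k"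
  have x': "\<forall>\<rho>\<in>Rows. (\<Sum>c\<in>C. ?A \<rho> c * x c) = of_int (b \<rho>)"
    using x unfolding solves_def by blast
  from solution_on_independent_columns[where Rows = Rows and A = ?A and x = x and b = "\<lambda>\<rho>. of_int (b \<rho>)",
      OF assms(2) x'] obtain J z where J: "J \<subseteq> C"
    and z': "\<forall>\<rho>\<in>Rows. (\<Sum>c\<in>J. ?A \<rho> c * z c) = of_int (b \<rho>)"
    and J': "\<forall>y. (\<forall>\<rho>\<in>Rows. (\<Sum>c\<in>J. ?A \<rho> c * y c) = 0) \<longrightarrow> (\<forall>c\<in>J. y c = 0)"
    by (elim exE conjE) (rule that)
  have z: "(\<Sum>c\<in>J. ?A \<rho> c * z c) = of_int (b \<rho>)" if "\<rho> \<in> Rows" for \<rho>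
    using z' that by blast
  have finJ: "finite J" using J assms(2) by (rule finite_subset)
  from square_subsystem[where A = ?A, OF assms(1) finJ J'] obtain I where I: "I \<subseteq> Rows" "card I = card J"
    and I': "\<forall>y. (\<forall>\<rho>\<in>I. (\<Sum>c\<in>J. ?A \<rho> c * y c) = 0) \<longrightarrow> (\<forall>c\<in>J. y c = 0)"
    by (elim exE conjE) (rule that)
  have Iind: "\<forall>c\<in>J. y c = 0" if "\<forall>\<rho>\<in>I. (\<Sum>c\<in>J. ?A \<rho> c * y c) = 0" for y
    using I' that by blast
  have finI: "finite I" using I(1) assms(1) by (rule finite_subset)
  define k where "k = card J"
  have kC: "k \<le> card C" unfolding k_def by (rule card_mono[OF assms(2) J])
  obtain row where row: "bij_betw row {0..<k} I"
    using ex_bij_betw_nat_finite[OF finI] I(2) k_def by auto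
  obtain col where col: "bij_betw col {0..<k} J"
    using ex_bij_betw_nat_finite[OF finJ] k_def by auto
  have rowI: "row i \<in> I" if "i < k" for i using row that by (auto simp: bij_betw_def)
  have colJ: "col i \<in> J" if "i < k" for i using col that by (auto simp: bij_betw_def)
  have sumJ: "(\<Sum>c\<in>J. f c) = (\<Sum>j = 0..<k. f (col j))" for f :: "'c \<Rightarrow> 'v::comm_monoid_add"
    by (rule sum.reindex_bij_betw[OF col, symmetric])
  define M where "M = mat k k (\<lambda>(i, j). A (row i) (col j))"
  define bv where "bv = vec k (\<lambda>i. b (row i))"
  have M: "M \<in> carrier_mat k k" by (simp add: M_def)
  define d where "d = det M"
  \<comment> \<open>the numerators in Cramer's rule\<close>
  define u where "u = (\<lambda>j. det (replace_col M bv j))"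
  let ?MK = "map_mat of_int M :: 'k mat"
  have MK: "?MK \<in> carrier_mat k k" using M by simp
  have H0: "0 \<le> H" using H by simp
  have le_B: "fact k * H ^ k * (int k * H + H) \<le> B"
  proof -
    have "fact k * H ^ k * (int k * H + H) = fact (k + 1) * H ^ (k + 1)"
      by (simp add: algebra_simps)
    also have "\<dots> \<le> B" unfolding B
      using kC H by (intro mult_mono fact_mono power_increasing) auto
    finally show ?thesis .
  qed
  have minor_le: "fact k * H ^ k \<le> B"
  proof -
    have "fact k * H ^ k * 1 \<le> fact k * H ^ k * (int k * H + H)"
      using H by (intro mult_left_mono) (auto simp: add_increasing)
    from order.trans[OF this le_B] show ?thesis by (simp only: mult_1_right)
  qed
  have d_bound: "\<bar>d\<bar> \<le> fact k * H ^ k"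
    unfolding d_def using J I(1) rowI colJ by (intro abs_det_le[OF M]) (auto simp: M_def intro!: AH)
  have u_bound: "\<bar>u j\<bar> \<le> fact k * H ^ k" if "j < k" for j
    unfolding u_def using J I(1) rowI colJ
    by (intro abs_det_le) (auto simp: M_def bv_def replace_col_def intro!: AH bH)
  have "det ?MK \<noteq> 0"
  proof
    assume "det ?MK = 0"
    then obtain v where v: "v \<in> carrier_vec k" "v \<noteq> 0\<^sub>v k" "?MK *\<^sub>v v = 0\<^sub>v k"
      using det_0_iff_vec_prod_zero[OF MK] by blast
    define y where "y = (\<lambda>c. vec_index v (the_inv_into {0..<k} col c))"
    have y: "y (col j) = vec_index v j" if "j < k" for j
      using col that by (simp add: y_def bij_betw_def the_inv_into_f_f)
    have "\<forall>\<rho>\<in>I. (\<Sum>c\<in>J. ?A \<rho> c * y c) = 0"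
    proof
      fix \<rho> assume "\<rho> \<in> I"
      then obtain i where i: "i < k" "\<rho> = row i" using row by (auto simp: bij_betw_def)
      have "(\<Sum>c\<in>J. ?A \<rho> c * y c) = vec_index (?MK *\<^sub>v v) i"
        using i v(1) by (simp add: sumJ scalar_prod_def M_def y)
      then show "(\<Sum>c\<in>J. ?A \<rho> c * y c) = 0" using v(3) i by simp
    qed
    from Iind[OF this] have "vec_index v j = 0" if "j < k" for j
      using y[OF that] colJ[OF that] by simp
    then have "v = 0\<^sub>v k" using v(1) by (intro eq_vecI) auto
    with v(2) show False by blast
  qed
  then have dK: "(of_int d :: 'k) \<noteq> 0" by (simp add: d_def of_int_hom.hom_det)
  then have "d \<noteq> 0" by auto
  then have dL: "(of_int d :: 'l) \<noteq> 0" using L[of d] d_bound minor_le by linarith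
  have cramer: "(of_int (u j) :: 'k) = z (col j) * of_int d" if j: "j < k" for j
  proof -
    let ?zv = "vec k (\<lambda>j. z (col j))"
    have "?MK *\<^sub>v ?zv = map_vec of_int bv"
    proof (rule eq_vecI)
      fix i assume "i < dim_vec (map_vec of_int bv :: 'k vec)"
      then have i: "i < k" by (simp add: bv_def)
      have "vec_index (?MK *\<^sub>v ?zv) i = (\<Sum>c\<in>J. ?A (row i) c * z c)"
        using i by (simp add: sumJ scalar_prod_def M_def)
      then show "vec_index (?MK *\<^sub>v ?zv) i = vec_index (map_vec of_int bv) i"
        using z[of "row i"] rowI[OF i] I(1) i by (auto simp: bv_def)
    qed (simp add: M_def bv_def)
    moreover have "replace_col ?MK (map_vec of_int bv) j = map_mat of_int (replace_col M bv j)"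
      by (rule eq_matI) (auto simp: replace_col_def M_def bv_def)
    ultimately have "of_int (u j) = det (replace_col ?MK (?MK *\<^sub>v ?zv) j)"
      by (simp add: u_def of_int_hom.hom_det)
    also have "\<dots> = z (col j) * of_int d"
      using cramer_lemma_mat[OF MK _ j, of ?zv] j by (simp add: d_def of_int_hom.hom_det)
    finally show ?thesis .
  qed
  have relation: "(\<Sum>j = 0..<k. A \<rho> (col j) * u j) = d * b \<rho>" if \<rho>: "\<rho> \<in> Rows" for \<rho>
  proof -
    \<comment> \<open>the defect is zero in the first field by Cramer's rule, and too small to vanish there by accident\<close>
    let ?t = "(\<Sum>j = 0..<k. A \<rho> (col j) * u j) - d * b \<rho>"
    have "(of_int ?t :: 'k) = of_int d * ((\<Sum>c\<in>J. ?A \<rho> c * z c) - of_int (b \<rho>))"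
      by (simp add: cramer sumJ algebra_simps sum_distrib_left)
    also have "\<dots> = 0" using z[OF \<rho>] by simp
    finally have zero: "(of_int ?t :: 'k) = 0" .
    have "\<bar>\<Sum>j = 0..<k. A \<rho> (col j) * u j\<bar> \<le> (\<Sum>j = 0..<k. \<bar>A \<rho> (col j) * u j\<bar>)" by (rule sum_abs)
    also have "\<dots> \<le> (\<Sum>j = 0..<k. H * (fact k * H ^ k))"
      using J colJ H0 by (intro sum_mono) (auto simp: abs_mult intro!: mult_mono AH[OF \<rho>] u_bound)
    finally have 1: "\<bar>\<Sum>j = 0..<k. A \<rho> (col j) * u j\<bar> \<le> int k * (H * (fact k * H ^ k))" by simp
    have 2: "\<bar>d * b \<rho>\<bar> \<le> (fact k * H ^ k) * H"
      unfolding abs_mult using H0 by (intro mult_mono d_bound bH[OF \<rho>]) auto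
    have "\<bar>?t\<bar> \<le> int k * (H * (fact k * H ^ k)) + (fact k * H ^ k) * H" using 1 2 by linarith
    also have "\<dots> = fact k * H ^ k * (int k * H + H)" by (simp add: algebra_simps)
    finally show ?thesis using K[of ?t] zero le_B by simp
  qed
  define y where "y = (\<lambda>c. if c \<in> J then of_int (u (the_inv_into {0..<k} col c)) / of_int d else 0 :: 'l)"
  have y: "y (col j) = of_int (u j) / of_int d" if "j < k" for j
    using col that colJ by (simp add: y_def bij_betw_def the_inv_into_f_f)
  have "(\<Sum>c\<in>C. of_int (A \<rho> c) * y c) = of_int (b \<rho>)" if \<rho>: "\<rho> \<in> Rows" for \<rho>
  proof -
    have "(\<Sum>c\<in>C. of_int (A \<rho> c) * y c) = (\<Sum>c\<in>J. of_int (A \<rho> c) * y c)"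
      using J assms(2) by (intro sum.mono_neutral_right) (auto simp: y_def)
    also have "\<dots> = of_int (\<Sum>j = 0..<k. A \<rho> (col j) * u j) / of_int d"
      by (simp add: sumJ y sum_divide_distrib)
    also have "\<dots> = of_int (b \<rho>)" unfolding relation[OF \<rho>] using dL by simp
    finally show ?thesis .
  qed
  then show ?thesis unfolding solves_def by blast
qed

section \<open>Transfer of common zeros between fields\<close>

lemma ideal_upto_coefficients:
  assumes "finite F" "ideal_upto N D (f ` F) h"
  shows "\<exists>g. (\<forall>\<tau>\<in>F. polyfun N D (g \<tau>)) \<and> (\<forall>a. h a = (\<Sum>\<tau>\<in>F. g \<tau> a * f \<tau> a))"
  using assms(2)
proof (induction rule: ideal_upto.induct)
  case zero
  show ?case by (intro exI[of _ "\<lambda>_ _. 0"]) (simp add: polyfun.const)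
next
  case (step f0 g0 h)
  obtain g where g: "\<forall>\<tau>\<in>F. polyfun N D (g \<tau>)" "\<forall>a. h a = (\<Sum>\<tau>\<in>F. g \<tau> a * f \<tau> a)"
    using step.IH by blast
  obtain \<sigma> where \<sigma>: "\<sigma> \<in> F" "f0 = f \<sigma>" using step.hyps(1) by blast
  let ?g = "\<lambda>\<tau> a. (if \<tau> = \<sigma> then g0 a else 0) + g \<tau> a"
  have "polyfun N D (?g \<tau>)" if "\<tau> \<in> F" for \<tau>
    using g(1) that step.hyps(2) by (cases "\<tau> = \<sigma>") (auto intro: polyfun.add)
  moreover have "g0 a * f0 a + h a = (\<Sum>\<tau>\<in>F. ?g \<tau> a * f \<tau> a)" for a
  proof -
    have "(\<Sum>\<tau>\<in>F. ?g \<tau> a * f \<tau> a)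
      = (\<Sum>\<tau>\<in>F. if \<tau> = \<sigma> then g0 a * f \<tau> a else 0) + (\<Sum>\<tau>\<in>F. g \<tau> a * f \<tau> a)"
      unfolding sum.distrib[symmetric] by (intro sum.cong) (auto simp: distrib_right)
    then show ?thesis using g(2) \<sigma> assms(1) by simp
  qed
  ultimately show ?case by (intro exI[of _ ?g]) blast
qed

text \<open>
  The linear system for certificates of bounded degree: the unknowns are the coefficients of the
  multipliers, indexed by a member \<open>\<tau>\<close> of the family and an exponent vector \<open>e\<close>, and there is one
  equation for every grid point \<open>u\<close>, namely that the certificate has the value \<open>1\<close> at \<open>u\<close>.
\<close>

definition certificate_matrix ::
  "nat \<Rightarrow> ('i \<Rightarrow> (nat \<Rightarrow> int) \<Rightarrow> int) \<Rightarrow> (nat \<Rightarrow> nat) \<Rightarrow> 'i \<times> (nat \<Rightarrow> nat) \<Rightarrow> int" where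
  "certificate_matrix N f u = (\<lambda>(\<tau>, e). monomial_at N e (\<lambda>i. int (u i)) * f \<tau> (\<lambda>i. int (u i)))"

lemma of_int_monomial_at:
  "of_int (monomial_at N e a) = monomial_at N e (\<lambda>i. of_int (a i))"
  by (simp add: monomial_at_def)

lemma of_int_certificate_matrix:
  assumes "\<And>a. of_int (f \<tau> a) = fK \<tau> (\<lambda>i. of_int (a i) :: 'k::comm_ring_1)"
  shows "of_int (certificate_matrix N f u (\<tau>, e))
    = monomial_at N e (\<lambda>i. of_nat (u i) :: 'k) * fK \<tau> (\<lambda>i. of_nat (u i))"
  by (simp add: certificate_matrix_def of_int_monomial_at assms)

lemma certificate_if_no_common_zero:
  fixes fK :: "'i \<Rightarrow> (nat \<Rightarrow> 'k::alg_closed_field) \<Rightarrow> 'k"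
  assumes F: "finite F" and fK: "\<And>\<tau>. \<tau> \<in> F \<Longrightarrow> polyfun N d (fK \<tau>)"
    and of_int: "\<And>\<tau> a. \<tau> \<in> F \<Longrightarrow> of_int (f \<tau> a) = fK \<tau> (\<lambda>i. of_int (a i))"
    and no_zero: "\<And>a. \<exists>\<tau>\<in>F. fK \<tau> a \<noteq> 0"
  shows "\<exists>x :: _ \<Rightarrow> 'k. solves Rows (F \<times> ({..<N} \<rightarrow>\<^sub>E {..nullstellensatz_degree N d}))
           (certificate_matrix N f) (\<lambda>_. 1) x"
proof -
  let ?D = "nullstellensatz_degree N d"
  have "ideal_upto N ?D (fK ` F) (\<lambda>_. 1)"
    by (rule effective_nullstellensatz) (use fK no_zero in auto)
  from ideal_upto_coefficients[OF F this] obtain g where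
    g: "\<And>\<tau>. \<tau> \<in> F \<Longrightarrow> polyfun N ?D (g \<tau>)" and
    one: "\<And>a. 1 = (\<Sum>\<tau>\<in>F. g \<tau> a * fK \<tau> a)" by blast
  have "\<forall>\<tau>. \<exists>c. \<tau> \<in> F \<longrightarrow> (\<forall>a. g \<tau> a = (\<Sum>e\<in>{..<N} \<rightarrow>\<^sub>E {..?D}. c e * monomial_at N e a))"
    using polyfun_monomial_expansion[OF g] by blast
  from choice[OF this] obtain c where
    c: "\<And>\<tau> a. \<tau> \<in> F \<Longrightarrow> g \<tau> a = (\<Sum>e\<in>{..<N} \<rightarrow>\<^sub>E {..?D}. c \<tau> e * monomial_at N e a)" by blast
  have "(\<Sum>x\<in>F \<times> ({..<N} \<rightarrow>\<^sub>E {..?D}). of_int (certificate_matrix N f u x) * (case x of (\<tau>, e) \<Rightarrow> c \<tau> e)) = 1"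
    for u
  proof -
    let ?u = "\<lambda>i. of_nat (u i) :: 'k"
    have "(\<Sum>x\<in>F \<times> ({..<N} \<rightarrow>\<^sub>E {..?D}). of_int (certificate_matrix N f u x) * (case x of (\<tau>, e) \<Rightarrow> c \<tau> e))
      = (\<Sum>\<tau>\<in>F. \<Sum>e\<in>{..<N} \<rightarrow>\<^sub>E {..?D}. of_int (certificate_matrix N f u (\<tau>, e)) * c \<tau> e)"
      by (simp add: sum.cartesian_product case_prod_unfold)
    also have "\<dots> = (\<Sum>\<tau>\<in>F. g \<tau> ?u * fK \<tau> ?u)"
    proof (rule sum.cong[OF refl])
      fix \<tau> assume \<tau>: "\<tau> \<in> F"
      show "(\<Sum>e\<in>{..<N} \<rightarrow>\<^sub>E {..?D}. of_int (certificate_matrix N f u (\<tau>, e)) * c \<tau> e)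
        = g \<tau> ?u * fK \<tau> ?u"
        unfolding of_int_certificate_matrix[where f = f and fK = fK, OF of_int[OF \<tau>]] c[OF \<tau>] sum_distrib_right
        by (simp add: ac_simps)
    qed
    finally show ?thesis using one by simp
  qed
  then show ?thesis unfolding solves_def
    by (intro exI[of _ "\<lambda>(\<tau>, e). c \<tau> e"]) simp
qed

text \<open>
  The difference of the two sides of a certificate has degree at most \<open>N D + d\<close>, so vanishing on the grid
  makes it vanish everywhere, in particular at a supposed common zero.
\<close>

lemma no_common_zero_if_certificate:
  fixes fK :: "'i \<Rightarrow> (nat \<Rightarrow> 'k::idom) \<Rightarrow> 'k" and x :: "'i \<times> (nat \<Rightarrow> nat) \<Rightarrow> 'k"
  assumes F: "finite F" and fK: "\<And>\<tau>. \<tau> \<in> F \<Longrightarrow> polyfun N d (fK \<tau>)"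
    and of_int: "\<And>\<tau> a. \<tau> \<in> F \<Longrightarrow> of_int (f \<tau> a) = fK \<tau> (\<lambda>i. of_int (a i))"
    and inj: "inj_on (of_nat :: nat \<Rightarrow> 'k) {..N * D + d}"
    and x: "solves ({..<N} \<rightarrow>\<^sub>E {..N * D + d}) (F \<times> ({..<N} \<rightarrow>\<^sub>E {..D})) (certificate_matrix N f) (\<lambda>_. 1) x"
  shows "\<exists>\<tau>\<in>F. fK \<tau> a \<noteq> 0"
proof -
  let ?E = "{..<N} \<rightarrow>\<^sub>E {..D}"
  let ?g = "\<lambda>\<tau> a. \<Sum>e\<in>?E. x (\<tau>, e) * monomial_at N e a"
  let ?h = "\<lambda>a. (\<Sum>\<tau>\<in>F. ?g \<tau> a * fK \<tau> a) - 1"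
  have "polyfun N (N * D + d) ?h"
    by (intro polyfun_diff polyfun_sum polyfun_mult polyfun_scale polyfun_monomial_at fK polyfun.const)
  moreover have "?h (\<lambda>i. of_nat (u i)) = 0" if u: "u \<in> {..<N} \<rightarrow>\<^sub>E {..N * D + d}" for u
  proof -
    let ?u = "\<lambda>i. of_nat (u i) :: 'k"
    have "(\<Sum>\<tau>\<in>F. ?g \<tau> ?u * fK \<tau> ?u)
      = (\<Sum>\<tau>\<in>F. \<Sum>e\<in>?E. of_int (certificate_matrix N f u (\<tau>, e)) * x (\<tau>, e))"
    proof (rule sum.cong[OF refl])
      fix \<tau> assume \<tau>: "\<tau> \<in> F"
      show "?g \<tau> ?u * fK \<tau> ?u = (\<Sum>e\<in>?E. of_int (certificate_matrix N f u (\<tau>, e)) * x (\<tau>, e))"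
        unfolding of_int_certificate_matrix[where f = f and fK = fK, OF of_int[OF \<tau>]] sum_distrib_right
        by (simp add: ac_simps)
    qed
    also have "\<dots> = (\<Sum>z\<in>F \<times> ?E. of_int (certificate_matrix N f u z) * x z)"
      by (simp add: sum.cartesian_product case_prod_unfold)
    also have "\<dots> = of_int 1" using bspec[OF x[unfolded solves_def] u] .
    finally show ?thesis by simp
  qed
  ultimately have "?h a = 0" by (rule polyfun_zero_if_zero_on_grid[OF _ inj])
  then have "(\<Sum>\<tau>\<in>F. ?g \<tau> a * fK \<tau> a) \<noteq> 0" by simp
  moreover have "(\<Sum>\<tau>\<in>F. ?g \<tau> a * fK \<tau> a) = 0" if "\<forall>\<tau>\<in>F. fK \<tau> a = 0"
    using that by (intro sum.neutral) simp
  ultimately show ?thesis by blast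
qed

text \<open>
  A certificate over \<open>'k\<close> would be transferred to \<open>'l\<close>, where it contradicts the given common zero. Here
  \<open>H\<close> bounds the entries of the linear system, \<open>C\<close> is the number of its unknowns, and \<open>B\<close> is the bound
  required for \<open>linear_system_transfer\<close>.
\<close>

lemma common_zero_transfer_one_way:
  fixes fK :: "'i \<Rightarrow> (nat \<Rightarrow> 'k::alg_closed_field) \<Rightarrow> 'k" and fL :: "'i \<Rightarrow> (nat \<Rightarrow> 'l::field) \<Rightarrow> 'l"
  assumes F: "finite F"
    and fK: "\<And>\<tau>. \<tau> \<in> F \<Longrightarrow> polyfun N d (fK \<tau>)" and fL: "\<And>\<tau>. \<tau> \<in> F \<Longrightarrow> polyfun N d (fL \<tau>)"
    and of_intK: "\<And>\<tau> a. \<tau> \<in> F \<Longrightarrow> of_int (f \<tau> a) = fK \<tau> (\<lambda>i. of_int (a i))"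
    and of_intL: "\<And>\<tau> a. \<tau> \<in> F \<Longrightarrow> of_int (f \<tau> a) = fL \<tau> (\<lambda>i. of_int (a i))"
    and D: "D = nullstellensatz_degree N d" and G: "G = N * D + d" "0 < d"
    and bound: "\<And>\<tau> u. \<tau> \<in> F \<Longrightarrow> (\<And>i. i < N \<Longrightarrow> u i \<le> G) \<Longrightarrow> \<bar>f \<tau> (\<lambda>i. int (u i))\<bar> \<le> V"
    and V: "1 \<le> V" and H: "H = int G ^ (N * D + 1) * V"
    and C: "C = card F * (D + 1) ^ N" and B: "B = fact (C + 1) * H ^ (C + 1)"
    and K: "\<And>t. \<bar>t\<bar> \<le> B \<Longrightarrow> (of_int t :: 'k) = 0 \<Longrightarrow> t = 0"
    and L: "\<And>t. \<bar>t\<bar> \<le> B \<Longrightarrow> (of_int t :: 'l) = 0 \<Longrightarrow> t = 0"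
    and zero: "\<exists>a. \<forall>\<tau>\<in>F. fL \<tau> a = 0"
  shows "\<exists>a. \<forall>\<tau>\<in>F. fK \<tau> a = 0"
proof (rule ccontr)
  assume "\<nexists>a. \<forall>\<tau>\<in>F. fK \<tau> a = 0"
  then have no_zero: "\<And>a. \<exists>\<tau>\<in>F. fK \<tau> a \<noteq> 0" by blast
  let ?E = "{..<N} \<rightarrow>\<^sub>E {..D}" and ?Rows = "{..<N} \<rightarrow>\<^sub>E {..G}"
  have "1 \<le> G" using G by simp
  then have G1: "1 \<le> int G" by simp
  \<comment> \<open>this is what the additional factor \<open>G\<close> in \<open>H\<close> is for: the grid coordinates stay distinct in \<open>'l\<close>\<close>
  have GH: "int G \<le> H"
  proof -
    have "int G ^ 1 * 1 \<le> H" unfolding H using G1 V by (intro mult_mono power_increasing) auto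
    then show ?thesis by simp
  qed
  have H1: "1 \<le> H" using GH G1 by simp
  have HB: "H \<le> B"
  proof -
    have "(1 :: int) \<le> fact (C + 1)" by (rule fact_ge_1)
    then have "1 * H ^ 1 \<le> fact (C + 1) * H ^ (C + 1)"
      using H1 by (intro mult_mono power_increasing) auto
    then show ?thesis by (simp add: B)
  qed
  have cardC: "card (F \<times> ?E) = C" by (simp add: C card_cartesian_product card_PiE)
  have fin: "finite ?Rows" "finite (F \<times> ?E)" using F by (auto intro!: finite_PiE)
  have entry: "\<bar>certificate_matrix N f u x\<bar> \<le> H" if u: "u \<in> ?Rows" and x: "x \<in> F \<times> ?E" for u x
  proof -
    obtain \<tau> e where \<tau>: "x = (\<tau>, e)" "\<tau> \<in> F" and e: "e \<in> ?E" using x by auto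
    have "\<bar>monomial_at N e (\<lambda>i. int (u i))\<bar> = (\<Prod>i<N. int (u i) ^ e i)"
      by (simp add: monomial_at_def abs_prod)
    also have "\<dots> \<le> (\<Prod>i<N. int G ^ D)"
    proof (rule prod_mono, intro conjI)
      fix i assume i: "i \<in> {..<N}"
      have "int (u i) ^ e i \<le> int G ^ e i" using u i by (intro power_mono) auto
      also have "\<dots> \<le> int G ^ D" using e i G1 by (intro power_increasing) auto
      finally show "int (u i) ^ e i \<le> int G ^ D" .
    qed simp
    also have "\<dots> = int G ^ (N * D)" by (simp add: power_mult mult.commute)
    also have "\<dots> \<le> int G ^ (N * D + 1)" using G1 by (intro power_increasing) auto
    finally have "\<bar>monomial_at N e (\<lambda>i. int (u i))\<bar> \<le> int G ^ (N * D + 1)" .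
    moreover have "\<bar>f \<tau> (\<lambda>i. int (u i))\<bar> \<le> V" using u by (intro bound \<tau>(2)) auto
    ultimately show ?thesis
      unfolding H \<tau>(1) certificate_matrix_def by (auto simp: abs_mult intro!: mult_mono)
  qed
  obtain x :: "_ \<Rightarrow> 'k" where x: "solves ?Rows (F \<times> ?E) (certificate_matrix N f) (\<lambda>_. 1) x"
    using certificate_if_no_common_zero[OF F fK of_intK no_zero] unfolding D by blast
  have "\<exists>y :: _ \<Rightarrow> 'l. solves ?Rows (F \<times> ?E) (certificate_matrix N f) (\<lambda>_. 1) y"
    by (rule linear_system_transfer[OF fin H1 entry _ _ K L x]) (use H1 in \<open>auto simp: B cardC\<close>)
  then obtain y :: "_ \<Rightarrow> 'l" where
    y: "solves ({..<N} \<rightarrow>\<^sub>E {..N * D + d}) (F \<times> ?E) (certificate_matrix N f) (\<lambda>_. 1) y"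
    unfolding G(1) by blast
  have "inj_on (of_nat :: nat \<Rightarrow> 'l) {..N * D + d}"
  proof (rule inj_onI)
    fix i j assume ij: "i \<in> {..N * D + d}" "j \<in> {..N * D + d}" "(of_nat i :: 'l) = of_nat j"
    then have "(of_int (int i - int j) :: 'l) = 0" by simp
    moreover have "\<bar>int i - int j\<bar> \<le> B"
    proof -
      have "int i \<le> int G" "int j \<le> int G" using ij(1,2) unfolding G(1) by (simp_all only: atMost_iff of_nat_le_iff)
      then show ?thesis using GH HB by linarith
    qed
    ultimately show "i = j" using L[of "int i - int j"] by simp
  qed
  from no_common_zero_if_certificate[OF F fL of_intL this y] zero show False by blast
qed

section \<open>Sums-of-squares formulas as polynomial systems\<close>

definition biquadratic_monomial :: "nat \<Rightarrow> nat \<Rightarrow> nat \<Rightarrow> nat \<Rightarrow> var \<Rightarrow>\<^sub>0 nat" where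
  "biquadratic_monomial j j' k k' =
     Poly_Mapping.single (X j) 1 + Poly_Mapping.single (X j') 1 +
     Poly_Mapping.single (Y k) 1 + Poly_Mapping.single (Y k') 1"

definition index_quadruples :: "nat \<Rightarrow> nat \<Rightarrow> (nat \<times> nat \<times> nat \<times> nat) set" where
  "index_quadruples r s = {1..r} \<times> {1..s} \<times> {1..r} \<times> {1..s}"

text \<open>
  The coefficient of \<open>\<mu>\<close> in the difference of the two sides of a formula with coefficients \<open>\<alpha>\<close>. Summing
  over all index quadruples with a given monomial avoids a case distinction between squares and mixed
  products.
\<close>

definition sos_equation ::
  "nat \<Rightarrow> nat \<Rightarrow> nat \<Rightarrow> (var \<Rightarrow>\<^sub>0 nat) \<Rightarrow> (nat \<Rightarrow> nat \<Rightarrow> nat \<Rightarrow> 'k::comm_ring_1) \<Rightarrow> 'k" where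
  "sos_equation r s n \<mu> \<alpha> =
     (\<Sum>i=1..n. \<Sum>(j, k, j', k')\<in>index_quadruples r s.
        if biquadratic_monomial j j' k k' = \<mu> then \<alpha> i j k * \<alpha> i j' k' else 0) -
     (\<Sum>(j, k)\<in>{1..r} \<times> {1..s}. if biquadratic_monomial j j k k = \<mu> then 1 else 0)"

definition sos_monomials :: "nat \<Rightarrow> nat \<Rightarrow> (var \<Rightarrow>\<^sub>0 nat) set" where
  "sos_monomials r s = (\<lambda>(j, k, j', k'). biquadratic_monomial j j' k k') ` index_quadruples r s"

lemma finite_index_quadruples: "finite (index_quadruples r s)"
  by (simp add: index_quadruples_def)

lemma finite_sos_monomials: "finite (sos_monomials r s)"
  by (simp add: sos_monomials_def finite_index_quadruples)

lemma card_sos_monomials: "card (sos_monomials r s) \<le> (r * s)\<^sup>2"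
proof -
  have "card (sos_monomials r s) \<le> card (index_quadruples r s)"
    unfolding sos_monomials_def by (rule card_image_le[OF finite_index_quadruples])
  also have "\<dots> = (r * s)\<^sup>2" by (simp add: index_quadruples_def power2_eq_square)
  finally show ?thesis .
qed

lemma sos_monomialsI:
  "(j, k, j', k') \<in> index_quadruples r s \<Longrightarrow> biquadratic_monomial j j' k k' \<in> sos_monomials r s"
  unfolding sos_monomials_def by (rule image_eqI[of _ _ "(j, k, j', k')"]) (simp_all only: case_prod_conv)

lemma sos_equation_trivial:
  assumes "\<mu> \<notin> sos_monomials r s"
  shows "sos_equation r s n \<mu> \<alpha> = 0"
proof -
  have 1: "biquadratic_monomial j j' k k' \<noteq> \<mu>" if "(j, k, j', k') \<in> index_quadruples r s" for j j' k k'
    using assms sos_monomialsI[OF that] by metis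
  have 2: "biquadratic_monomial j j k k \<noteq> \<mu>" if "(j, k) \<in> {1..r} \<times> {1..s}" for j k
    using 1[of j k j k] that by (auto simp: index_quadruples_def)
  have "(\<Sum>(j, k, j', k')\<in>index_quadruples r s.
        if biquadratic_monomial j j' k k' = \<mu> then \<alpha> i j k * \<alpha> i j' k' else 0) = 0" for i
    using 1 by (intro sum.neutral) auto
  moreover have "(\<Sum>(j, k)\<in>{1..r} \<times> {1..s}. if biquadratic_monomial j j k k = \<mu> then 1 else (0::'a)) = 0"
    using 2 by (intro sum.neutral) auto
  ultimately show ?thesis by (simp add: sos_equation_def)
qed

lemma Const_Var_Var:
  "Const c * Var v * Var w = Poly_Mapping.single (Poly_Mapping.single v 1 + Poly_Mapping.single w 1) c"
  by (simp add: Const_def Var_def mult_single)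

lemma bilinear_square:
  fixes \<beta> :: "nat \<Rightarrow> nat \<Rightarrow> 'k::comm_ring_1"
  shows "(\<Sum>j=1..r. \<Sum>k=1..s. Const (\<beta> j k) * Var (X j) * Var (Y k))\<^sup>2
    = (\<Sum>(j, k, j', k')\<in>index_quadruples r s.
         Poly_Mapping.single (biquadratic_monomial j j' k k') (\<beta> j k * \<beta> j' k'))"
proof -
  have "(\<Sum>j=1..r. \<Sum>k=1..s. Const (\<beta> j k) * Var (X j) * Var (Y k))\<^sup>2
    = (\<Sum>j=1..r. \<Sum>k=1..s. \<Sum>j'=1..r. \<Sum>k'=1..s.
         Poly_Mapping.single (biquadratic_monomial j j' k k') (\<beta> j k * \<beta> j' k'))"
    unfolding power2_eq_square Const_Var_Var sum_distrib_right sum_distrib_left mult_single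
    by (intro sum.cong refl) (simp add: biquadratic_monomial_def ac_simps)
  also have "\<dots> = (\<Sum>(j, k, j', k')\<in>index_quadruples r s.
         Poly_Mapping.single (biquadratic_monomial j j' k k') (\<beta> j k * \<beta> j' k'))"
    by (simp add: index_quadruples_def sum.cartesian_product case_prod_unfold)
  finally show ?thesis .
qed

lemma norm_product:
  "(\<Sum>j=1..r. Var (X j) ^ 2) * (\<Sum>k=1..s. Var (Y k) ^ 2)
    = (\<Sum>(j, k)\<in>{1..r} \<times> {1..s}. Poly_Mapping.single (biquadratic_monomial j j k k) (1::'k::comm_ring_1))"
proof -
  have "(\<Sum>j=1..r. Var (X j) ^ 2) * (\<Sum>k=1..s. Var (Y k) ^ 2)
    = (\<Sum>j=1..r. \<Sum>k=1..s. Poly_Mapping.single (biquadratic_monomial j j k k) (1::'k))"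
    unfolding power2_eq_square Var_def sum_distrib_right sum_distrib_left mult_single
    by (subst sum.swap, intro sum.cong refl) (simp add: biquadratic_monomial_def ac_simps)
  then show ?thesis by (simp add: sum.cartesian_product)
qed

lemma sos_formula_iff_equations:
  "sos_formula_exists TYPE('k::field) r s n \<longleftrightarrow>
     (\<exists>\<alpha> :: nat \<Rightarrow> nat \<Rightarrow> nat \<Rightarrow> 'k. \<forall>\<mu>\<in>sos_monomials r s. sos_equation r s n \<mu> \<alpha> = 0)"
proof -
  let ?z = "\<lambda>\<alpha> i. \<Sum>j=1..r. \<Sum>k=1..s. Const (\<alpha> i j k :: 'k) * Var (X j) * Var (Y k)"
  let ?lhs = "(\<Sum>j=1..r. Var (X j) ^ 2) * (\<Sum>k=1..s. Var (Y k) ^ 2) :: 'k xy_poly"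
  have identity: "?lhs = (\<Sum>i=1..n. (?z \<alpha> i)\<^sup>2) \<longleftrightarrow> (\<forall>\<mu>\<in>sos_monomials r s. sos_equation r s n \<mu> \<alpha> = 0)"
    for \<alpha> :: "nat \<Rightarrow> nat \<Rightarrow> nat \<Rightarrow> 'k"
  proof -
    have single: "Poly_Mapping.lookup (Poly_Mapping.single m c) \<mu> = (if m = \<mu> then c else 0)" for m \<mu> and c :: 'k
      by (simp add: lookup_single when_def)
    have "Poly_Mapping.lookup (\<Sum>i=1..n. (?z \<alpha> i)\<^sup>2) \<mu> - Poly_Mapping.lookup ?lhs \<mu> = sos_equation r s n \<mu> \<alpha>"
      for \<mu>
      unfolding bilinear_square norm_product sos_equation_def
      by (simp only: lookup_sum single case_prod_unfold)
    then have "?lhs = (\<Sum>i=1..n. (?z \<alpha> i)\<^sup>2) \<longleftrightarrow> (\<forall>\<mu>. sos_equation r s n \<mu> \<alpha> = 0)"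
      by (auto simp: poly_mapping_eq_iff fun_eq_iff)
    then show ?thesis using sos_equation_trivial by blast
  qed
  show ?thesis
  proof
    assume "sos_formula_exists TYPE('k) r s n"
    then obtain z :: "nat \<Rightarrow> 'k xy_poly" where
      z: "\<And>i. i \<in> {1..n} \<Longrightarrow> bilinear_expr r s (z i)" and eq: "?lhs = (\<Sum>i=1..n. z i ^ 2)"
      unfolding sos_formula_exists_def by blast
    have "\<forall>i. \<exists>\<beta>. i \<in> {1..n} \<longrightarrow> z i = (\<Sum>j=1..r. \<Sum>k=1..s. Const (\<beta> j k) * Var (X j) * Var (Y k))"
      using z unfolding bilinear_expr_def by blast
    from choice[OF this] obtain \<alpha> where \<alpha>: "\<forall>i. i \<in> {1..n} \<longrightarrow> z i = ?z \<alpha> i" by blast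
    have "(\<Sum>i=1..n. z i ^ 2) = (\<Sum>i=1..n. (?z \<alpha> i)\<^sup>2)"
      by (rule sum.cong[OF refl]) (use \<alpha> in simp)
    with eq have "?lhs = (\<Sum>i=1..n. (?z \<alpha> i)\<^sup>2)" by (rule trans)
    then show "\<exists>\<alpha> :: nat \<Rightarrow> nat \<Rightarrow> nat \<Rightarrow> 'k. \<forall>\<mu>\<in>sos_monomials r s. sos_equation r s n \<mu> \<alpha> = 0"
      by (intro exI[of _ \<alpha>]) (rule iffD1[OF identity])
  next
    assume "\<exists>\<alpha> :: nat \<Rightarrow> nat \<Rightarrow> nat \<Rightarrow> 'k. \<forall>\<mu>\<in>sos_monomials r s. sos_equation r s n \<mu> \<alpha> = 0"
    then obtain \<alpha> where "?lhs = (\<Sum>i=1..n. (?z \<alpha> i)\<^sup>2)" using identity by blast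
    moreover have "bilinear_expr r s (?z \<alpha> i)" for i unfolding bilinear_expr_def by blast
    ultimately show "sos_formula_exists TYPE('k) r s n"
      unfolding sos_formula_exists_def by (intro exI[of _ "?z \<alpha>"] conjI ballI)
  qed
qed

lemma biquadratic_monomial_eq_iff:
  "biquadratic_monomial j j' k k' = biquadratic_monomial a a' b b' \<longleftrightarrow>
     (j = a \<and> j' = a' \<or> j = a' \<and> j' = a) \<and> (k = b \<and> k' = b' \<or> k = b' \<and> k' = b)"
  (is "?l = ?r \<longleftrightarrow> ?x \<and> ?y")
proof
  assume eq: "?l = ?r"
  have lookup: "Poly_Mapping.lookup (biquadratic_monomial j j' k k') v =
      (if X j = v then 1 else 0) + (if X j' = v then 1 else 0) + (if Y k = v then 1 else 0)
      + (if Y k' = v then 1 else 0)" for j j' k k' v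
    by (simp add: biquadratic_monomial_def lookup_add lookup_single when_def del: One_nat_def split del: if_split)
  have *: "(if X j = v then 1 else 0) + (if X j' = v then 1 else 0) + (if Y k = v then 1 else 0)
      + (if Y k' = v then 1 else 0) = (if X a = v then 1 else 0) + (if X a' = v then 1 else 0)
      + (if Y b = v then 1 else 0) + (if Y b' = v then 1 else (0::nat))" for v
    using arg_cong[OF eq, of "\<lambda>m. Poly_Mapping.lookup m v"] unfolding lookup .
  have pair: "u = w \<and> u' = w' \<or> u = w' \<and> u' = w"
    if "1 + (if u' = u then 1 else 0) = (if w = u then 1 else 0) + (if w' = u then 1 else (0::nat))"
      "(if u = u' then 1 else 0) + 1 = (if w = u' then 1 else 0) + (if w' = u' then 1 else (0::nat))"
    for u u' w w' :: nat
    using that by presburger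
  have ?x
    by (rule pair) (use *[of "X j"] *[of "X j'"] in \<open>simp_all split del: if_split\<close>)
  moreover have ?y
    by (rule pair) (use *[of "Y k"] *[of "Y k'"] in \<open>simp_all split del: if_split\<close>)
  ultimately show "?x \<and> ?y" ..
next
  assume "?x \<and> ?y"
  then show "?l = ?r" by (auto simp: biquadratic_monomial_def ac_simps)
qed

text \<open>
  For a concrete monomial the index sets consist of at most two elements and can be listed.
\<close>

lemma sos_equation_restricted:
  assumes Q: "{(j, k, j', k'). (j, k, j', k') \<in> index_quadruples r s \<and> biquadratic_monomial j j' k k' = \<mu>} = Q"
    and P: "{(j, k). (j, k) \<in> {1..r} \<times> {1..s} \<and> biquadratic_monomial j j k k = \<mu>} = P"
  shows "sos_equation r s n \<mu> \<alpha> =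
    (\<Sum>i=1..n. \<Sum>(j, k, j', k')\<in>Q. \<alpha> i j k * \<alpha> i j' k') - of_nat (card P)"
proof -
  let ?mon = "\<lambda>(j, k, j', k'). biquadratic_monomial j j' k k'"
  let ?mon2 = "\<lambda>(j, k). biquadratic_monomial j j k k"
  have Q': "Q = {t \<in> index_quadruples r s. ?mon t = \<mu>}" using Q by auto
  have P': "P = {t \<in> {1..r} \<times> {1..s}. ?mon2 t = \<mu>}" using P by auto
  have "(\<Sum>(j, k, j', k')\<in>index_quadruples r s.
        if biquadratic_monomial j j' k k' = \<mu> then \<alpha> i j k * \<alpha> i j' k' else 0)
      = (\<Sum>(j, k, j', k')\<in>Q. \<alpha> i j k * \<alpha> i j' k')" for i
    unfolding Q' sum.inter_filter[OF finite_index_quadruples] by (intro sum.cong) auto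
  moreover have "(\<Sum>(j, k)\<in>{1..r} \<times> {1..s}. if biquadratic_monomial j j k k = \<mu> then 1 else (0::'a))
      = (\<Sum>t\<in>P. 1)"
    unfolding P' by (subst sum.inter_filter) (auto intro!: sum.cong)
  ultimately show ?thesis by (simp add: sos_equation_def)
qed

text \<open>
  Look at the coefficients of \<open>x\<^sub>a x\<^sub>a' y\<^sub>b\<^sup>2\<close>. A mixed product occurs twice, so orthogonality is obtained only
  after division by \<open>2\<close>.
\<close>

lemma sos_columns_orthonormal:
  fixes \<alpha> :: "nat \<Rightarrow> nat \<Rightarrow> nat \<Rightarrow> 'k::field"
  assumes two: "(2 :: 'k) \<noteq> 0" and eqs: "\<forall>\<mu>\<in>sos_monomials r s. sos_equation r s n \<mu> \<alpha> = 0"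
    and a: "a \<in> {1..r}" "a' \<in> {1..r}" and b: "b \<in> {1..s}"
  shows "(\<Sum>i=1..n. \<alpha> i a b * \<alpha> i a' b) = (if a = a' then 1 else 0)"
proof -
  let ?\<mu> = "biquadratic_monomial a a' b b"
  have "(a, b, a', b) \<in> index_quadruples r s" using a b by (simp add: index_quadruples_def)
  then have zero: "sos_equation r s n ?\<mu> \<alpha> = 0" using eqs sos_monomialsI by blast
  have Q: "{(j, k, j', k'). (j, k, j', k') \<in> index_quadruples r s \<and> biquadratic_monomial j j' k k' = ?\<mu>}
    = {(a, b, a', b), (a', b, a, b)}"
    unfolding biquadratic_monomial_eq_iff index_quadruples_def using a b by auto
  have P: "{(j, k). (j, k) \<in> {1..r} \<times> {1..s} \<and> biquadratic_monomial j j k k = ?\<mu>}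
    = (if a = a' then {(a, b)} else {})"
    unfolding biquadratic_monomial_eq_iff using a b by auto
  have *: "(\<Sum>i=1..n. \<Sum>(j, k, j', k')\<in>{(a, b, a', b), (a', b, a, b)}. \<alpha> i j k * \<alpha> i j' k')
    = (if a = a' then 1 else 0)"
    using zero unfolding sos_equation_restricted[OF Q P] by (simp split: if_splits)
  show ?thesis
  proof (cases "a = a'")
    case True
    then show ?thesis using * by simp
  next
    case False
    let ?s = "\<Sum>i=1..n. \<alpha> i a b * \<alpha> i a' b"
    have "?s + ?s = (\<Sum>i=1..n. \<alpha> i a b * \<alpha> i a' b + \<alpha> i a b * \<alpha> i a' b)"
      by (rule sum.distrib[symmetric])
    also have "\<dots> = (\<Sum>i=1..n. \<Sum>(j, k, j', k')\<in>{(a, b, a', b), (a', b, a, b)}. \<alpha> i j k * \<alpha> i j' k')"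
      using False by (intro sum.cong refl) (simp add: mult.commute)
    also have "\<dots> = 0" using * False by (simp only: if_False)
    finally have "?s + ?s = 0" .
    then have "2 * ?s = 0" by (simp only: mult_2)
    then have "?s = 0" using two mult_eq_0_iff by blast
    then show ?thesis using False by simp
  qed
qed

lemma sos_rows_orthonormal:
  fixes \<alpha> :: "nat \<Rightarrow> nat \<Rightarrow> nat \<Rightarrow> 'k::field"
  assumes two: "(2 :: 'k) \<noteq> 0" and eqs: "\<forall>\<mu>\<in>sos_monomials r s. sos_equation r s n \<mu> \<alpha> = 0"
    and a: "a \<in> {1..r}" and b: "b \<in> {1..s}" "b' \<in> {1..s}"
  shows "(\<Sum>i=1..n. \<alpha> i a b * \<alpha> i a b') = (if b = b' then 1 else 0)"
proof -
  let ?\<mu> = "biquadratic_monomial a a b b'"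
  have "(a, b, a, b') \<in> index_quadruples r s" using a b by (simp add: index_quadruples_def)
  then have zero: "sos_equation r s n ?\<mu> \<alpha> = 0" using eqs sos_monomialsI by blast
  have Q: "{(j, k, j', k'). (j, k, j', k') \<in> index_quadruples r s \<and> biquadratic_monomial j j' k k' = ?\<mu>}
    = {(a, b, a, b'), (a, b', a, b)}"
    unfolding biquadratic_monomial_eq_iff index_quadruples_def using a b by auto
  have P: "{(j, k). (j, k) \<in> {1..r} \<times> {1..s} \<and> biquadratic_monomial j j k k = ?\<mu>}
    = (if b = b' then {(a, b)} else {})"
    unfolding biquadratic_monomial_eq_iff using a b by auto
  have *: "(\<Sum>i=1..n. \<Sum>(j, k, j', k')\<in>{(a, b, a, b'), (a, b', a, b)}. \<alpha> i j k * \<alpha> i j' k')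
    = (if b = b' then 1 else 0)"
    using zero unfolding sos_equation_restricted[OF Q P] by (simp split: if_splits)
  show ?thesis
  proof (cases "b = b'")
    case True
    then show ?thesis using * by simp
  next
    case False
    let ?s = "\<Sum>i=1..n. \<alpha> i a b * \<alpha> i a b'"
    have "?s + ?s = (\<Sum>i=1..n. \<alpha> i a b * \<alpha> i a b' + \<alpha> i a b * \<alpha> i a b')"
      by (rule sum.distrib[symmetric])
    also have "\<dots> = (\<Sum>i=1..n. \<Sum>(j, k, j', k')\<in>{(a, b, a, b'), (a, b', a, b)}. \<alpha> i j k * \<alpha> i j' k')"
      using False by (intro sum.cong refl) (simp add: mult.commute)
    also have "\<dots> = 0" using * False by (simp only: if_False)
    finally have "?s + ?s = 0" .
    then have "2 * ?s = 0" by (simp only: mult_2)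
    then have "?s = 0" using two mult_eq_0_iff by blast
    then show ?thesis using False by simp
  qed
qed

text \<open>
  More than \<open>n\<close> vectors of length \<open>n\<close> are linearly dependent, but pairing a dependency with one of the
  vectors isolates its coefficient.
\<close>

lemma orthonormal_family_le:
  fixes \<beta> :: "nat \<Rightarrow> nat \<Rightarrow> 'k::field"
  assumes "\<And>a a'. a \<in> {1..r} \<Longrightarrow> a' \<in> {1..r} \<Longrightarrow>
    (\<Sum>i=1..n. \<beta> i a * \<beta> i a') = (if a = a' then 1 else 0)"
  shows "r \<le> n"
proof (rule ccontr)
  assume "\<not> r \<le> n"
  then have "card {1..n} < card {1..r}" by simp
  from nontrivial_kernel[OF _ _ this, of \<beta>] obtain y c where c: "c \<in> {1..r}" "y c \<noteq> 0"
    and y: "\<And>i. i \<in> {1..n} \<Longrightarrow> (\<Sum>a=1..r. \<beta> i a * y a) = 0" by blast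
  have "0 = (\<Sum>i=1..n. \<beta> i c * (\<Sum>a=1..r. \<beta> i a * y a))"
    by (rule sum.neutral[symmetric]) (simp add: y del: One_nat_def)
  also have "\<dots> = (\<Sum>a=1..r. (\<Sum>i=1..n. \<beta> i c * \<beta> i a) * y a)"
    unfolding sum_distrib_left sum_distrib_right by (subst sum.swap) (simp add: ac_simps)
  also have "\<dots> = (\<Sum>a=1..r. if c = a then y a else 0)"
    by (rule sum.cong[OF refl]) (simp add: assms[OF c(1)] del: One_nat_def)
  also have "\<dots> = y c" using c(1) by simp
  finally show False using c(2) by simp
qed

lemma sos_formula_dimension_bound:
  assumes "(2 :: 'k::field) \<noteq> 0" "r > 0" "s > 0" "sos_formula_exists TYPE('k) r s n"
  shows "r \<le> n" "s \<le> n"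
proof -
  obtain \<alpha> :: "nat \<Rightarrow> nat \<Rightarrow> nat \<Rightarrow> 'k" where
    eqs: "\<forall>\<mu>\<in>sos_monomials r s. sos_equation r s n \<mu> \<alpha> = 0"
    using assms(4) sos_formula_iff_equations by blast
  have one: "1 \<in> {1..r}" "1 \<in> {1..s}" using assms by auto
  show "r \<le> n"
    by (rule orthonormal_family_le[where \<beta> = "\<lambda>i a. \<alpha> i a 1"])
      (rule sos_columns_orthonormal[OF assms(1) eqs _ _ one(2)])
  show "s \<le> n"
    by (rule orthonormal_family_le[where \<beta> = "\<lambda>i b. \<alpha> i 1 b"])
      (rule sos_rows_orthonormal[OF assms(1) eqs one(1)])
qed

section \<open>Numerical bounds and the theorem\<close>

lemma elimination_degree_le:
  assumes "2 \<le> d"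
  shows "elimination_degree d \<le> d ^ 5"
proof -
  have "Suc d \<le> 2 * d" using assms by simp
  also have "\<dots> \<le> d * d" using assms by (intro mult_le_mono) auto
  finally have "Suc d \<le> d * d" .
  then have "d * (2 * d * Suc d) \<le> d * (d * d * (d * d))" using assms by (intro mult_le_mono) auto
  then show ?thesis by (simp add: elimination_degree_def power_def numeral_eq_Suc ac_simps)
qed

lemma elimination_degree_ge: "2 \<le> d \<Longrightarrow> 2 \<le> elimination_degree d"
  unfolding elimination_degree_def by (cases d) auto

text \<open>
  The exponent \<open>6\<close> in place of the \<open>5\<close> of \<open>elimination_degree_le\<close> absorbs the summand
  \<open>elimination_degree d\<close> of the recursion.
\<close>

lemma nullstellensatz_degree_le:
  assumes "2 \<le> d"
  shows "nullstellensatz_degree N d \<le> d ^ 6 ^ N"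
  using assms
proof (induction N arbitrary: d)
  case (Suc N)
  let ?E = "elimination_degree d" and ?L = "6 ^ N :: nat"
  have E: "?E \<le> d ^ 5" "2 \<le> ?E" using elimination_degree_le elimination_degree_ge Suc.prems by auto
  have "nullstellensatz_degree (Suc N) d \<le> ?E ^ ?L + ?E" using Suc.IH[OF E(2)] by simp
  also have "\<dots> \<le> (d ^ 5) ^ ?L + (d ^ 5) ^ 1" using E(1) by (intro add_mono power_mono) auto
  also have "\<dots> \<le> (d ^ 5) ^ ?L + (d ^ 5) ^ ?L"
    using Suc.prems by (intro add_left_mono power_increasing) auto
  also have "\<dots> = 2 * d ^ (5 * ?L)" by (simp add: power_mult)
  also have "\<dots> \<le> d ^ ?L * d ^ (5 * ?L)"
    using Suc.prems self_le_power[of d ?L] by (intro mult_le_mono) auto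
  also have "\<dots> = d ^ 6 ^ Suc N" by (simp add: power_add[symmetric])
  finally show ?case .
qed simp

text \<open>
  Everything is estimated by powers of \<open>2\<close>. With \<open>L = 6 ^ N\<close> the number of unknowns is about \<open>2 ^ (N L)\<close> and
  the entries have about \<open>2 ^ (N + L)\<close> times \<open>N + L\<close> binary digits, so the logarithm of the bound is at most
  \<open>2 ^ ((N + 2) L + 4 N + 4)\<close>; the exponent is at most \<open>(N + 6) L \<le> 7 ^ N * 6 ^ N = 42 ^ N\<close>.
\<close>

lemma certificate_bound:
  fixes N D G T C :: nat and V H :: int
  assumes N: "0 < N" and D: "D \<le> 2 ^ 6 ^ N" and G: "G = N * D + 2"
    and V: "V = 2 * (int N)\<^sup>2 * (int G)\<^sup>2" and H: "H = int G ^ (N * D + 1) * V"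
    and C: "C = T * (D + 1) ^ N" and T: "T \<le> N\<^sup>2"
  shows "fact (C + 1) * H ^ (C + 1) \<le> 2 ^ 2 ^ (45 ^ N)"
proof -
  define L :: nat where "L = 6 ^ N"
  have N2: "N + 1 \<le> 2 ^ N" using less_exp[of N] by linarith
  have NL: "N + 1 \<le> L" unfolding L_def using N2 power_mono[of "2::nat" 6 N] by linarith
  have L1: "(1::nat) \<le> 2 ^ L" by simp
  have DL: "D \<le> 2 ^ L" using D by (simp add: L_def)
  then have "D + 1 \<le> 2 * 2 ^ L" using L1 by linarith
  then have D1: "D + 1 \<le> 2 ^ (L + 1)" by simp
  have "N * D + 2 \<le> N * 2 ^ L + 2 ^ L"
  proof -
    have "(2::nat) ^ 1 \<le> 2 ^ L" using NL N by (intro power_increasing) auto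
    then show ?thesis using DL by (intro add_mono mult_le_mono) auto
  qed
  also have "\<dots> = (N + 1) * 2 ^ L" by simp
  also have "\<dots> \<le> 2 ^ N * 2 ^ L" using N2 by (intro mult_le_mono) auto
  finally have GL: "G \<le> 2 ^ (N + L)" by (simp add: G power_add)
  then have ND: "N * D + 1 \<le> 2 ^ (N + L)" by (simp add: G)
  have Nle: "N \<le> 2 ^ N" using N2 by simp
  define c where "c = N * L + 3 * N + 1"
  have "C \<le> (2 ^ N)\<^sup>2 * (2 ^ (L + 1)) ^ N"
    unfolding C
  proof (rule mult_le_mono)
    have "N\<^sup>2 \<le> (2 ^ N)\<^sup>2" using Nle by (rule power_mono) simp
    with T show "T \<le> (2 ^ N)\<^sup>2" by (rule le_trans)
    show "(D + 1) ^ N \<le> (2 ^ (L + 1)) ^ N" using D1 by (rule power_mono) simp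
  qed
  also have "\<dots> = 2 ^ (N * L + 3 * N)"
    by (simp add: power_mult[symmetric] power_add[symmetric] algebra_simps)
  finally have C_le: "C \<le> 2 ^ (N * L + 3 * N)" .
  have "(1::nat) \<le> 2 ^ (N * L + 3 * N)" by simp
  with C_le have "C + 1 \<le> 2 ^ (N * L + 3 * N) + 2 ^ (N * L + 3 * N)" by (rule add_mono)
  also have "\<dots> = 2 ^ c" by (simp add: c_def)
  finally have Cc: "C + 1 \<le> 2 ^ c" .
  have NZ: "int N \<le> 2 ^ N" using Nle by (metis of_nat_le_iff of_nat_numeral of_nat_power)
  have GZ: "int G \<le> 2 ^ (N + L)" using GL by (metis of_nat_le_iff of_nat_numeral of_nat_power)
  define v where "v = 1 + N * 2 + (N + L) * 2"
  have V': "V \<le> 2 ^ v"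
  proof -
    have "(int N)\<^sup>2 \<le> (2 ^ N)\<^sup>2" by (rule power_mono[OF NZ]) simp
    moreover have "(int G)\<^sup>2 \<le> (2 ^ (N + L))\<^sup>2" by (rule power_mono[OF GZ]) simp
    ultimately have "V \<le> 2 * (2 ^ N)\<^sup>2 * (2 ^ (N + L))\<^sup>2" unfolding V by (intro mult_mono) auto
    also have "\<dots> = 2 ^ v" by (simp only: v_def power_mult[symmetric] power_add[of _ "1 + N * 2"] power_add[of _ 1] power_one_right)
    finally show ?thesis .
  qed
  define h where "h = (N + L) * 2 ^ (N + L) + v"
  have H': "H \<le> 2 ^ h"
  proof -
    have "int G ^ (N * D + 1) \<le> (2 ^ (N + L)) ^ (N * D + 1)"
      by (rule power_mono[OF GZ]) simp
    also have "\<dots> \<le> (2 ^ (N + L)) ^ (2 ^ (N + L))" using ND by (intro power_increasing) auto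
    finally have "H \<le> (2 ^ (N + L)) ^ (2 ^ (N + L)) * 2 ^ v"
      unfolding H using V' V by (intro mult_mono) auto
    also have "\<dots> = 2 ^ h" by (simp add: h_def power_add power_mult)
    finally show ?thesis .
  qed
  have H0: "0 \<le> H" by (simp add: H V)
  have "(fact (C + 1) :: int) \<le> int ((C + 1) ^ (C + 1))"
    using fact_le_power[of "C + 1"] by (metis of_nat_fact of_nat_le_iff of_nat_power)
  also have "\<dots> \<le> int ((2 ^ c) ^ (C + 1))" using Cc by (intro of_nat_mono power_mono) auto
  finally have "fact (C + 1) * H ^ (C + 1) \<le> (2 ^ c) ^ (C + 1) * (2 ^ h) ^ (C + 1)"
    using H' H0 by (intro mult_mono power_mono) auto
  also have "\<dots> = 2 ^ ((c + h) * (C + 1))"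
    by (simp only: power_mult_distrib[symmetric] power_add[symmetric] power_mult)
  also have "\<dots> \<le> 2 ^ 2 ^ (45 ^ N)"
  proof (rule power_increasing)
    have "c + h \<le> 2 ^ (N + 2 * L + 3)"
    proof -
      define P :: nat where "P = 2 ^ L * 2 ^ (N + L)"
      have "N + 2 * L + 3 = 3 + (L + (N + L))" by simp
      then have P8: "2 ^ (N + 2 * L + 3) = 8 * P" unfolding P_def by (simp only: power_add) simp
      have L2: "L + 1 \<le> 2 ^ L" using less_exp[of L] by linarith
      have L_le: "2 ^ L \<le> (2::nat) ^ (N + L)" by (intro power_increasing) auto
      have "N * L \<le> 2 ^ N * 2 ^ L" using Nle L2 by (intro mult_le_mono) auto
      also have "\<dots> = 1 * 2 ^ (N + L)" by (simp add: power_add)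
      also have "\<dots> \<le> P" unfolding P_def by (rule mult_le_mono1) simp
      finally have 1: "N * L \<le> P" .
      have "N + L \<le> 2 * 2 ^ L" using NL L2 by linarith
      then have "(N + L) * 2 ^ (N + L) \<le> 2 * 2 ^ L * 2 ^ (N + L)" by (rule mult_le_mono1)
      then have 2: "(N + L) * 2 ^ (N + L) \<le> 2 * P" by (simp only: P_def mult.assoc)
      have "2 * (L + 1) \<le> 2 ^ L * 2 ^ L" using L2 NL N by (intro mult_le_mono) linarith+
      also have "\<dots> \<le> P" unfolding P_def using L_le by (rule mult_le_mono2)
      finally have 3: "2 * (L + 1) \<le> P" .
      have "c + h = N * L + (N + L) * 2 ^ (N + L) + (7 * N + 2 * L + 2)"
        by (simp add: c_def h_def v_def)
      also have "\<dots> \<le> P + 2 * P + (7 * N + 2 * L + 2)" using 1 2 by (intro add_mono) auto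
      also have "7 * N + 2 * L + 2 \<le> 5 * P" using 3 NL by simp
      finally show ?thesis unfolding P8 by simp
    qed
    then have "(c + h) * (C + 1) \<le> 2 ^ (N + 2 * L + 3) * 2 ^ c" using Cc by (intro mult_le_mono)
    also have "\<dots> = 2 ^ (N + 2 * L + 3 + c)" by (rule power_add[symmetric])
    also have "N + 2 * L + 3 + c = (N + 2) * L + 4 * N + 4" by (simp add: c_def algebra_simps)
    also have "(2::nat) ^ ((N + 2) * L + 4 * N + 4) \<le> 2 ^ (45 ^ N)"
    proof (rule power_increasing)
      have "4 * N + 4 \<le> 4 * L" using NL by simp
      then have "(N + 2) * L + 4 * N + 4 \<le> (N + 6) * L" by (simp add: algebra_simps)
      also have "\<dots> \<le> 7 ^ N * 6 ^ N"
      proof -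
        have "N + 6 \<le> 7 ^ N" using N
        proof (induction N rule: nat_induct_non_zero)
          case (Suc n)
          then show ?case by simp
        qed simp
        then show ?thesis unfolding L_def by (rule mult_le_mono1)
      qed
      also have "\<dots> = 42 ^ N" by (simp add: power_mult_distrib[symmetric])
      also have "\<dots> \<le> 45 ^ N" by (intro power_mono) auto
      finally show "(N + 2) * L + 4 * N + 4 \<le> 45 ^ N" .
    qed simp
    finally show "(c + h) * (C + 1) \<le> 2 ^ 45 ^ N" .
  qed simp
  finally show ?thesis .
qed

lemma two_cube_le: "0 < n \<Longrightarrow> 2 * n ^ 3 \<le> 4 ^ (n :: nat)"
proof -
  have "2 * n ^ 3 \<le> 4 ^ n" if "2 \<le> n" for n :: nat
    using that
  proof (induction n rule: dec_induct)
    case (step n)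
    have "2 * Suc n ^ 3 \<le> 4 * (2 * n ^ 3)"
    proof -
      obtain k where k: "n = k + 2" using step.hyps(1) by (metis le_add_diff_inverse2)
      show ?thesis unfolding k by (simp add: power3_eq_cube algebra_simps)
    qed
    then show ?case using step.IH by simp
  qed simp
  moreover assume "0 < n"
  ultimately show ?thesis by (cases "n = 1") auto
qed

lemma power_le_binomial:
  assumes "k * N \<le> D" "0 < N"
  shows "(k + 1) ^ N \<le> (N + D) choose D"
proof -
  have "(k + 1) * N \<le> N + D" using assms by simp
  then have "real (k + 1) * real N \<le> real (N + D)" by (metis of_nat_le_iff of_nat_mult)
  then have "real (k + 1) \<le> real (N + D) / real N" using assms(2) by (simp add: field_simps)
  then have "real (k + 1) ^ N \<le> (real (N + D) / real N) ^ N" by (intro power_mono) auto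
  also have "\<dots> \<le> real ((N + D) choose N)" by (rule binomial_ge_n_over_k_pow_k) simp
  also have "(N + D) choose N = (N + D) choose D" by (metis add_diff_cancel_left' binomial_symmetric le_add1)
  finally have "real ((k + 1) ^ N) \<le> real ((N + D) choose D)" by simp
  then show ?thesis by (simp only: of_nat_le_iff)
qed

text \<open>
  Since \<open>N \<le> n\<^sup>3\<close>, both \<open>4 ^ (2 ^ (n - 1) + 1) \<ge> 8 N\<close> and \<open>2 * 4 ^ (2 ^ (n - 1)) \<ge> 4 N\<close>; then
  \<open>power_le_binomial\<close> gives \<open>q \<ge> 9 ^ N\<close> and \<open>m \<ge> 5 ^ N\<close>.
\<close>

lemma exponent_lower_bound:
  assumes q: "q = (N + 4 ^ (2 ^ (n - 1) + 1)) choose (4 ^ (2 ^ (n - 1) + 1))"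
    and m: "m = (N + 2 * 4 ^ (2 ^ (n - 1))) choose (2 * 4 ^ (2 ^ (n - 1)))"
    and N: "0 < N" "N \<le> n ^ 3" "0 < n"
  shows "45 ^ N \<le> q * m"
proof -
  have "n \<le> 2 ^ (n - 1)" using less_exp[of "n - 1"] N(3) by linarith
  then have "(4::nat) ^ n \<le> 4 ^ 2 ^ (n - 1)" by (intro power_increasing) auto
  then have N2: "2 * N \<le> 4 ^ 2 ^ (n - 1)" using two_cube_le[OF N(3)] N(2) by linarith
  have "(8 + 1) ^ N \<le> q" unfolding q by (rule power_le_binomial) (use N2 N in auto)
  moreover have "(4 + 1) ^ N \<le> m" unfolding m by (rule power_le_binomial) (use N2 N in auto)
  ultimately have "9 ^ N * 5 ^ N \<le> q * m" by (intro mult_le_mono) auto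
  then show ?thesis by (simp add: power_mult_distrib[symmetric])
qed

text \<open>
  The exponent is a geometric sum, of which only the last term \<open>(5 * 2 ^ q - 3) ^ m \<ge> 2 ^ (q m)\<close> is kept.
\<close>

lemma prime_bound_lower:
  fixes q m :: nat
  shows "(2 :: nat) ^ 2 ^ (q * m) \<le>
    (2 ^ (3 * 2 ^ q - 2)) ^ (((5 * 2 ^ q - 3) ^ (m + 1) - 1) div (5 * 2 ^ q - 4))"
    (is "_ \<le> ?b ^ ?e")
proof -
  have one: "(1::nat) \<le> 2 ^ q" by simp
  define A :: nat where "A = 5 * 2 ^ q - 3"
  have A: "2 ^ q \<le> A" "1 < A" "5 * 2 ^ q - 4 = A - 1" using one unfolding A_def by linarith+
  have "A ^ m * (A - 1) \<le> A ^ (m + 1) - 1"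
  proof -
    have "1 \<le> A ^ m" using A by simp
    then show ?thesis by (simp add: diff_mult_distrib2 mult.commute diff_le_mono2)
  qed
  then have "A ^ m \<le> (A ^ (m + 1) - 1) div (A - 1)" using A(2) by (simp add: less_eq_div_iff_mult_less_eq)
  moreover have "2 ^ (q * m) \<le> A ^ m" using power_mono[OF A(1), of m] by (simp add: power_mult)
  ultimately have e: "2 ^ (q * m) \<le> ?e" unfolding A(3) A_def by linarith
  have "(2::nat) ^ 1 \<le> ?b" using one by (intro power_increasing) linarith+
  then have "2 ^ 2 ^ (q * m) \<le> ?b ^ 2 ^ (q * m)" by (intro power_mono) auto
  also have "\<dots> \<le> ?b ^ ?e" using e by (intro power_increasing) auto
  finally show ?thesis .
qed

lemma of_int_zero_small:
  assumes "CHAR('k::ring_1) = 0 \<or> B < int CHAR('k)" "\<bar>t\<bar> \<le> B" "(of_int t :: 'k) = 0"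
  shows "t = 0"
proof -
  have dvd: "int CHAR('k) dvd t" using assms(3) by (simp add: of_int_eq_0_iff_char_dvd)
  show ?thesis
  proof (rule ccontr)
    assume t: "t \<noteq> 0"
    then have "int CHAR('k) \<le> \<bar>t\<bar>" using dvd_imp_le_int[OF t dvd] by simp
    moreover have "CHAR('k) \<noteq> 0" using dvd t by auto
    ultimately show False using assms(1,2) by linarith
  qed
qed

lemma polyfun_sos_equation:
  assumes "\<And>i j k. i \<in> {1..n} \<Longrightarrow> j \<in> {1..r} \<Longrightarrow> k \<in> {1..s} \<Longrightarrow> idx (i, j, k) < N"
  shows "polyfun N 2 (\<lambda>a. sos_equation r s n \<mu> (\<lambda>i j k. a (idx (i, j, k)) :: 'k::comm_ring_1))"
proof -
  have product: "polyfun N 2 (\<lambda>a. a u * a v :: 'k)" if "u < N" "v < N" for u v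
    using polyfun_mult[OF polyfun_coord[OF that(1), of 1] polyfun_coord[OF that(2), of 1]]
    by (simp add: numeral_2_eq_2)
  have "polyfun N 2 (\<lambda>a. case t of (j, k, j', k') \<Rightarrow>
      if biquadratic_monomial j j' k k' = \<mu> then a (idx (i, j, k)) * a (idx (i, j', k')) else (0::'k))"
    if "i \<in> {1..n}" "t \<in> index_quadruples r s" for i t
  proof -
    obtain j k j' k' where t: "t = (j, k, j', k')" by (cases t)
    have "polyfun N 2 (\<lambda>a. a (idx (i, j, k)) * a (idx (i, j', k')) :: 'k)"
      using that by (intro product assms) (auto simp: t index_quadruples_def)
    then show ?thesis
      by (cases "biquadratic_monomial j j' k k' = \<mu>") (simp_all add: t polyfun.const)
  qed
  then show ?thesis
    unfolding sos_equation_def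
    by (intro polyfun_diff polyfun_sum polyfun.const)
qed

lemma of_int_sos_equation:
  "of_int (sos_equation r s n \<mu> \<alpha>) = sos_equation r s n \<mu> (\<lambda>i j k. of_int (\<alpha> i j k))"
  by (simp add: sos_equation_def case_prod_unfold if_distrib[of of_int] cong: if_cong)

lemma abs_sos_equation_le:
  fixes \<alpha> :: "nat \<Rightarrow> nat \<Rightarrow> nat \<Rightarrow> int"
  assumes \<alpha>: "\<And>i j k. i \<in> {1..n} \<Longrightarrow> j \<in> {1..r} \<Longrightarrow> k \<in> {1..s} \<Longrightarrow> \<bar>\<alpha> i j k\<bar> \<le> G"
    and pos: "0 < n" "0 < r" "0 < s" "1 \<le> G"
  shows "\<bar>sos_equation r s n \<mu> \<alpha>\<bar> \<le> 2 * (int (r * s * n))\<^sup>2 * G\<^sup>2"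
proof -
  let ?f = "\<lambda>i (j, k, j', k'). if biquadratic_monomial j j' k k' = \<mu> then \<alpha> i j k * \<alpha> i j' k' else 0"
  let ?g = "\<lambda>(j, k). if biquadratic_monomial j j k k = \<mu> then 1 else (0::int)"
  have f: "\<bar>?f i t\<bar> \<le> G\<^sup>2" if "i \<in> {1..n}" "t \<in> index_quadruples r s" for i t
    using that pos(4)
    by (auto simp: index_quadruples_def abs_mult power2_eq_square intro!: mult_mono \<alpha>)
  have "\<bar>\<Sum>i=1..n. \<Sum>t\<in>index_quadruples r s. ?f i t\<bar> \<le> (\<Sum>i=1..n. \<Sum>t\<in>index_quadruples r s. G\<^sup>2)"
    by (intro order.trans[OF sum_abs] sum_mono f)
  also have "\<dots> = int n * (int (r * s))\<^sup>2 * G\<^sup>2"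
    by (simp add: index_quadruples_def power2_eq_square)
  also have "\<dots> \<le> (int n)\<^sup>2 * (int (r * s))\<^sup>2 * G\<^sup>2"
    using pos by (intro mult_right_mono) (auto simp: power2_eq_square)
  also have "\<dots> = (int (r * s * n))\<^sup>2 * G\<^sup>2" by (simp add: power2_eq_square ac_simps)
  finally have 1: "\<bar>\<Sum>i=1..n. \<Sum>t\<in>index_quadruples r s. ?f i t\<bar> \<le> (int (r * s * n))\<^sup>2 * G\<^sup>2" .
  have "\<bar>\<Sum>t\<in>{1..r} \<times> {1..s}. ?g t\<bar> \<le> (\<Sum>t\<in>{1..r} \<times> {1..s}. 1)"
    by (intro order.trans[OF sum_abs] sum_mono) auto
  also have "\<dots> = int (r * s)" by simp
  also have "\<dots> \<le> (int (r * s * n))\<^sup>2 * G\<^sup>2"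
  proof -
    have "r * s \<le> r * s * n" using pos by simp
    also have "\<dots> \<le> (r * s * n)\<^sup>2" using pos by (simp add: power2_eq_square)
    finally have "int (r * s) \<le> (int (r * s * n))\<^sup>2" by (metis of_nat_le_iff of_nat_power)
    moreover have "1 \<le> G\<^sup>2" using pos by simp
    ultimately have "int (r * s) * 1 \<le> (int (r * s * n))\<^sup>2 * G\<^sup>2" by (intro mult_mono) auto
    then show ?thesis by simp
  qed
  finally have 2: "\<bar>\<Sum>t\<in>{1..r} \<times> {1..s}. ?g t\<bar> \<le> (int (r * s * n))\<^sup>2 * G\<^sup>2" .
  show ?thesis unfolding sos_equation_def using 1 2 by linarith
qed

text \<open>
  One direction of the equivalence for two fields of sufficiently large (or zero) characteristic. The
  coefficients \<open>\<alpha> i j k\<close> are numbered by a bijection \<open>idx\<close> to become the coordinates of a point.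
\<close>

lemma sos_formula_transfer:
  fixes r s n p :: nat
  assumes pos: "0 < r" "0 < s" "0 < n"
    and char: "CHAR('k::alg_closed_field) = 0 \<or> 2 ^ 2 ^ (45 ^ (r * s * n)) < CHAR('k)"
      "CHAR('l::field) = 0 \<or> 2 ^ 2 ^ (45 ^ (r * s * n)) < CHAR('l)"
    and ex: "sos_formula_exists TYPE('l) r s n"
  shows "sos_formula_exists TYPE('k) r s n"
proof -
  define N where "N = r * s * n"
  let ?I = "{1..n} \<times> {1..r} \<times> {1..s}"
  have "card ?I = N" by (simp add: N_def card_cartesian_product)
  then obtain idx where idx: "bij_betw idx ?I {..<N}"
    using ex_bij_betw_finite_nat[of ?I] by (auto simp: atLeast0LessThan)
  have idx_less: "idx (i, j, k) < N" if "i \<in> {1..n}" "j \<in> {1..r}" "k \<in> {1..s}" for i j k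
    using idx that by (auto simp: bij_betw_def)
  define D where "D = nullstellensatz_degree N 2"
  define G where "G = N * D + 2"
  define V where "V = 2 * (int N)\<^sup>2 * (int G)\<^sup>2"
  define H where "H = int G ^ (N * D + 1) * V"
  define C where "C = card (sos_monomials r s) * (D + 1) ^ N"
  define B where "B = fact (C + 1) * H ^ (C + 1)"
  have N: "0 < N" using pos by (simp add: N_def)
  have "(r * s)\<^sup>2 \<le> N\<^sup>2" using pos by (intro power_mono) (auto simp: N_def)
  then have "card (sos_monomials r s) \<le> N\<^sup>2" using card_sos_monomials[of r s] by linarith
  from certificate_bound[OF N _ G_def V_def H_def C_def this] nullstellensatz_degree_le[of 2 N]
  have B: "B \<le> 2 ^ 2 ^ (45 ^ N)" by (simp add: B_def D_def)
  have B_char: "CHAR('c::ring_1) = 0 \<or> B < int CHAR('c)"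
    if c: "CHAR('c) = 0 \<or> 2 ^ 2 ^ (45 ^ (r * s * n)) < CHAR('c)"
    using c
  proof
    assume "2 ^ 2 ^ (45 ^ (r * s * n)) < CHAR('c)"
    then have "int (2 ^ 2 ^ (45 ^ N)) < int CHAR('c)" unfolding N_def by (simp only: of_nat_less_iff)
    then have "2 ^ 2 ^ (45 ^ N) < int CHAR('c)" by (simp only: of_nat_power of_nat_numeral)
    with B have "B < int CHAR('c)" by (rule le_less_trans)
    then show ?thesis ..
  qed (rule disjI1)
  let ?f = "\<lambda>\<mu> a. sos_equation r s n \<mu> (\<lambda>i j k. a (idx (i, j, k)))"
  have bound: "\<bar>?f \<mu> (\<lambda>i. int (u i))\<bar> \<le> V" if "\<And>i. i < N \<Longrightarrow> u i \<le> G" for u \<mu>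
  proof -
    have "1 \<le> int G" by (simp add: G_def)
    then show ?thesis
      unfolding V_def N_def using that idx_less pos by (intro abs_sos_equation_le) auto
  qed
  have V: "1 \<le> V"
  proof -
    have "1 * 1 * 1 \<le> V" unfolding V_def using N by (intro mult_mono) (auto simp: G_def)
    then show ?thesis by simp
  qed
  obtain \<alpha> :: "nat \<Rightarrow> nat \<Rightarrow> nat \<Rightarrow> 'l" where
    \<alpha>: "\<forall>\<mu>\<in>sos_monomials r s. sos_equation r s n \<mu> \<alpha> = 0"
    using ex sos_formula_iff_equations by blast
  define b where "b = (\<lambda>i. case the_inv_into ?I idx i of (i, j, k) \<Rightarrow> \<alpha> i j k)"
  have b: "b (idx (i, j, k)) = \<alpha> i j k" if "i \<in> {1..n}" "j \<in> {1..r}" "k \<in> {1..s}" for i j k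
    using that idx by (simp add: b_def bij_betw_def the_inv_into_f_f del: One_nat_def)
  have "?f \<mu> b = sos_equation r s n \<mu> \<alpha>" for \<mu>
    unfolding sos_equation_def
    by (intro arg_cong2[of _ _ _ _ minus] sum.cong refl)
      (auto simp: index_quadruples_def b simp del: One_nat_def)
  with \<alpha> have "\<forall>\<mu>\<in>sos_monomials r s. ?f \<mu> b = 0" by simp
  then have zero: "\<exists>a :: nat \<Rightarrow> 'l. \<forall>\<mu>\<in>sos_monomials r s. ?f \<mu> a = 0" by (intro exI[of _ b])
  have "\<exists>a :: nat \<Rightarrow> 'k. \<forall>\<mu>\<in>sos_monomials r s. ?f \<mu> a = 0"
  proof (rule common_zero_transfer_one_way[where f = ?f and fK = ?f and fL = ?f,
        OF finite_sos_monomials _ _ _ _ D_def G_def _ _ V H_def C_def B_def _ _ zero])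
    show "polyfun N 2 (?f \<mu> :: (nat \<Rightarrow> 'k) \<Rightarrow> 'k)" for \<mu> by (rule polyfun_sos_equation) (rule idx_less)
    show "polyfun N 2 (?f \<mu> :: (nat \<Rightarrow> 'l) \<Rightarrow> 'l)" for \<mu> by (rule polyfun_sos_equation) (rule idx_less)
    show "t = 0" if "\<bar>t\<bar> \<le> B" "(of_int t :: 'k) = 0" for t
      by (rule of_int_zero_small[OF B_char[OF char(1)] that])
    show "t = 0" if "\<bar>t\<bar> \<le> B" "(of_int t :: 'l) = 0" for t
      by (rule of_int_zero_small[OF B_char[OF char(2)] that])
  qed (auto simp: of_int_sos_equation intro: bound)
  then obtain a :: "nat \<Rightarrow> 'k" where "\<forall>\<mu>\<in>sos_monomials r s. ?f \<mu> a = 0" by blast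
  then have "\<exists>\<alpha> :: nat \<Rightarrow> nat \<Rightarrow> nat \<Rightarrow> 'k. \<forall>\<mu>\<in>sos_monomials r s. sos_equation r s n \<mu> \<alpha> = 0"
    by (intro exI[of _ "\<lambda>i j k. a (idx (i, j, k))"])
  then show ?thesis using sos_formula_iff_equations by blast
qed

theorem theorem1p5:
  fixes r s n q m p :: nat
  assumes "r > 0" and "s > 0" and "n > 0"
    and "q = (r * s * n + 4 ^ (2 ^ (n - 1) + 1)) choose (4 ^ (2 ^ (n - 1) + 1))"
    and "m = (r * s * n + 2 * 4 ^ (2 ^ (n - 1))) choose (2 * 4 ^ (2 ^ (n - 1)))"
    and "prime p"
    and "p > (2 ^ (3 * 2 ^ q - 2)) ^ (((5 * 2 ^ q - 3) ^ (m + 1) - 1) div (5 * 2 ^ q - 4))"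
    and "CHAR('a::alg_closed_field) = 0"
    and "CHAR('b::alg_closed_field) = p"
  shows "sos_formula_exists TYPE('a) r s n \<longleftrightarrow> sos_formula_exists TYPE('b) r s n"
proof -
  have p: "2 ^ 2 ^ (q * m) < p" using prime_bound_lower[of q m] assms(7) by (rule le_less_trans)
  have "2 < p"
  proof -
    have "0 < q" "0 < m" unfolding assms(4,5) by (simp_all add: zero_less_binomial_iff)
    then have "(2::nat) ^ 1 \<le> 2 ^ 2 ^ (q * m)" by (intro power_increasing) auto
    then show ?thesis using p by simp
  qed
  have twoA: "(2 :: 'a) \<noteq> 0"
    using of_nat_eq_0_iff_char_dvd[of 2, where 'a = 'a] assms(8) by simp
  have twoB: "(2 :: 'b) \<noteq> 0"
    using of_nat_eq_0_iff_char_dvd[of 2, where 'a = 'b] assms(9) \<open>2 < p\<close> by (auto dest: dvd_imp_le)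
  show ?thesis
  proof (cases "r \<le> n \<and> s \<le> n")
    case False
    then show ?thesis
      using sos_formula_dimension_bound[OF twoA assms(1,2)] sos_formula_dimension_bound[OF twoB assms(1,2)]
      by blast
  next
    case True
    have "r * s * n \<le> n * n * n" using True by (intro mult_le_mono) auto
    then have "45 ^ (r * s * n) \<le> q * m"
      using assms(1-3) by (intro exponent_lower_bound[OF assms(4,5)]) (auto simp: power3_eq_cube)
    then have "(2::nat) ^ 2 ^ (45 ^ (r * s * n)) \<le> 2 ^ 2 ^ (q * m)" by (intro power_increasing) auto
    with p have "2 ^ 2 ^ (45 ^ (r * s * n)) < p" by (rule le_less_trans[rotated])
    then have char: "CHAR('a) = 0 \<or> 2 ^ 2 ^ (45 ^ (r * s * n)) < CHAR('a)"
      "CHAR('b) = 0 \<or> 2 ^ 2 ^ (45 ^ (r * s * n)) < CHAR('b)" using assms(8,9) by auto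
    show ?thesis
      using sos_formula_transfer[OF assms(1-3) char] sos_formula_transfer[OF assms(1-3) char(2,1)]
      by blast
  qed
qed

end
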